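(* Let $g:\mathbb{N}\to\mathbb{C}$ be an arithmetic function with $g(n)\ll 1$ for all $n\geq 1$, and let $f=\mathrm{id}\ast g$, i.e. $f(n)=\sum_{d\mid n} d\, g(n/d)$. Then \[ \sum_{n\leq x}\frac{f([x/n])}{[x/n]}=x\sum_{m\geq1}\frac{f(m)}{m^2(m+1)}+O(x^{1/3}\log x) \] as $x\rightarrow\infty$.
   Context: $[t]$ denotes the integral part of the real number $t$; $\mathrm{id}(n)=n$ for $n\ge1$, and $\ast$ denotes Dirichlet convolution. *)

theory Defs
  imports "HOL-Analysis.Analysis" "HOL-Library.Landau_Symbols"
begin

definition id_conv :: "(nat \<Rightarrow> complex) \<Rightarrow> nat \<Rightarrow> complex" where
  "id_conv g n = (\<Sum>d | d dvd n. of_nat d * g (n div d))"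

end

theory Submission
  imports Defs "HOL-Real_Asymp.Real_Asymp"
begin

text \<open>
  Put \<open>h(m) = f(m)/m\<close>, so that \<open>h(m)\<close> is the sum of \<open>g(d)/d\<close> over the divisors \<open>d\<close> of \<open>m\<close>,
  and let \<open>\<psi>(t) = t - [t] - 1/2\<close>. Split the sum at \<open>n = x\<^sup>4\<^sup>/\<^sup>9\<close>.
  For larger \<open>n\<close>, collect the \<open>n\<close> with \<open>[x/n] = m\<close>; the error is a sum over \<open>d\<close> of
  \<open>g(d)/d\<close> times a difference of sums of \<open>\<psi>(x/(dk))\<close> and \<open>\<psi>(x/(dk+1))\<close> over \<open>k\<close>.
  For smaller \<open>n\<close>, the indicator of \<open>d | [x/n]\<close> is
  \<open>1/d - \<psi>(x/(nd)) + \<psi>(x/(nd) - 1/d)\<close>. Here \<open>d > x\<^sup>1\<^sup>/\<^sup>3\<close> is treated trivially, because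
  \<open>n \<mapsto> [x/n]\<close> is injective in this range, and \<open>n \<le> x\<^sup>1\<^sup>/\<^sup>3\<close> by \<open>h(m) \<lless> log m\<close>.
  All sums of \<open>\<psi>\<close> run over dyadic blocks of hyperbolas \<open>y/(n + \<beta>) + c\<close>, on which van der Corput's
  second derivative test gives \<open>y\<^sup>1\<^sup>/\<^sup>3 + (K\<^sup>3/y)\<^sup>1\<^sup>/\<^sup>2\<close> for a block of length \<open>K\<close>; with \<open>y = x/d\<close>
  the sum over \<open>d\<close> converges and only the number of blocks costs a logarithm.
\<close>

section \<open>Exponential sums\<close>

text \<open>The cut is forced. Put \<open>X = x^(1/3)\<close>. For large \<open>n\<close> the
  quotient \<open>m = [x/n]\<close> runs up to \<open>M\<close>, and the second block term, with
  \<open>K = M/d\<close> and \<open>y = x/d\<close>, is \<open>(M^3/x)^(1/2) / d\<close>; it is at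
  most \<open>X/d\<close> exactly when \<open>M <= x^(5/9)\<close>. For small \<open>n\<close>, up
  to \<open>N\<close>, the same term is \<open>(N^3 d/x)^(1/2)\<close>, which for
  \<open>N = x^(4/9)\<close> is \<open>(X d)^(1/2)\<close>. Weighted by \<open>1/d\<close> and
  summed over \<open>d <= X\<close> it is again of order \<open>X\<close>; this is why exponential
  sums are replaced by the trivial count beyond \<open>d = X\<close>. Cutting the series at
  \<open>M\<close> leaves a tail that can be as large as \<open>x/M\<close>, about
  \<open>x^(4/9)\<close>, too large for an error term. It is cancelled rather than estimated: if
  \<open>D\<close> is the mean value of \<open>f(m)/m\<close>, then \<open>x\<close> times the tail
  is \<open>D x/(M+1)\<close> up to \<open>O(X)\<close>, while the \<open>n <= N = [x/(M+1)]\<close>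
  contribute \<open>D N\<close> up to the admissible error.\<close>

lemma sin_pi_ge:
  fixes t \<delta> :: real
  assumes "0 \<le> \<delta>" "\<delta> \<le> t" "t \<le> 1 - \<delta>"
  shows "2 * \<delta> \<le> sin (pi * t)"
proof -
  have conc: "concave_on {0..pi} sin"
    unfolding concave_on_def
  proof (rule f''_ge0_imp_convex)
    show "((\<lambda>x. - sin x) has_real_derivative - cos x) (at x)" for x :: real
      by (auto intro!: derivative_eq_intros)
    show "((\<lambda>x. - cos x) has_real_derivative sin x) (at x)" for x :: real
      by (auto intro!: derivative_eq_intros)
  qed (auto intro: sin_ge_zero)
  \<comment> \<open>On the first half the chord from \<open>0\<close> to \<open>pi/2\<close> lies
    below the concave graph; the reflection \<open>t -> 1 - t\<close> settles the second
    half.\<close>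
  have half: "2 * s \<le> sin (pi * s)" if "0 \<le> s" "s \<le> 1/2" for s :: real
  proof -
    have "(1 - 2 * s) * sin 0 + (2 * s) * sin (pi/2) \<le> sin ((1 - 2 * s) *\<^sub>R 0 + (2 * s) *\<^sub>R (pi/2))"
      using that by (intro concave_onD[OF conc]) auto
    then show ?thesis by (simp add: mult.commute)
  qed
  show ?thesis
  proof (cases "t \<le> 1/2")
    case True
    then show ?thesis using half[of t] assms by simp
  next
    case False
    have "sin (pi * (1 - t)) = sin (pi * t)"
      by (simp add: right_diff_distrib)
    then show ?thesis using half[of "1 - t"] False assms by simp
  qed
qed

section \<open>The Kusmin-Landau inequality\<close>

lemma cis_minus_one: "cis (2 * x) - 1 = 2 * \<i> * of_real (sin x) * cis x"
  by (auto simp: complex_eq_iff cos_double_sin sin_double power2_eq_square)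

lemma inverse_cis_minus_one:
  assumes "sin x \<noteq> 0"
  shows "1 / (cis (2 * x) - 1) = Complex (- 1 / 2) (- cot x / 2)"
proof -
  have "Complex (- 1 / 2) (- cot x / 2) * (2 * \<i> * of_real (sin x) * cis x) = 1"
    using assms sin_cos_squared_add[of x]
    by (auto simp: complex_eq_iff cot_def field_simps power2_eq_square)
  then show ?thesis
    unfolding cis_minus_one by (metis mult_zero_right nonzero_eq_divide_eq zero_neq_one)
qed

lemma cot_antimono:
  assumes "0 < x" "x \<le> y" "y < pi"
  shows "cot y \<le> cot x"
proof -
  have pos: "sin x > 0" "sin y > 0" "sin (y - x) \<ge> 0"
    using assms by (auto intro: sin_gt_zero sin_ge_zero)
  have "cot x - cot y = sin (y - x) / (sin x * sin y)"
    using pos by (simp add: cot_def sin_diff field_simps)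
  also have "\<dots> \<ge> 0" using pos by simp
  finally show ?thesis by simp
qed

text \<open>
  Writing \<open>e(F n) = (e(F (n + 1)) - e(F n)) / (e(\<theta> n) - 1)\<close>, summation by parts works because the
  factor \<open>1 / (e(\<theta>) - 1) = - 1/2 - (i/2) cot(\<pi> \<theta>)\<close> has a monotone imaginary part.
\<close>

lemma kusmin_landau:
  fixes F \<theta> :: "nat \<Rightarrow> real" and \<nu> :: int and \<delta> :: real
  defines "\<theta> \<equiv> \<lambda>n. F (Suc n) - F n"
  assumes "0 < \<delta>" "a \<le> b"
    and bounds: "\<And>n. a \<le> n \<Longrightarrow> n \<le> b \<Longrightarrow> \<nu> + \<delta> \<le> \<theta> n \<and> \<theta> n \<le> \<nu> + 1 - \<delta>"
    and mono: "\<And>n. a \<le> n \<Longrightarrow> n < b \<Longrightarrow> \<theta> n \<le> \<theta> (Suc n)"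
  shows "norm (\<Sum>n=a..b. cis (2 * pi * F n)) \<le> 1 / \<delta>"
proof -
  define \<phi> where "\<phi> n = pi * (\<theta> n - \<nu>)" for n
  define E where "E n = cis (2 * pi * F n)" for n
  define c where "c n = 1 / (cis (2 * \<phi> n) - 1)" for n
  define k where "k n = cot (\<phi> n) / 2" for n
  have sin_ge: "2 * \<delta> \<le> sin (\<phi> n)" if "a \<le> n" "n \<le> b" for n
    unfolding \<phi>_def using bounds[OF that] \<open>0 < \<delta>\<close> by (intro sin_pi_ge) auto
  have sin_pos: "0 < sin (\<phi> n)" if "a \<le> n" "n \<le> b" for n
    using sin_ge[OF that] \<open>0 < \<delta>\<close> by linarith
  have c_eq: "c n = Complex (- 1 / 2) (- k n)" if "a \<le> n" "n \<le> b" for n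
    unfolding c_def k_def using inverse_cis_minus_one[of "\<phi> n"] sin_pos[OF that] by simp
  have norm_c: "norm (c n) \<le> 1 / (4 * \<delta>)" if "a \<le> n" "n \<le> b" for n
    unfolding c_def cis_minus_one using sin_ge[OF that] \<open>0 < \<delta>\<close>
    by (simp add: norm_divide norm_mult frac_le)
  have abs_k: "\<bar>k n\<bar> \<le> 1 / (4 * \<delta>)" if "a \<le> n" "n \<le> b" for n
    using abs_Im_le_cmod[of "c n"] norm_c[OF that] c_eq[OF that] by simp
  have E_Suc: "E (Suc n) = E n * cis (2 * \<phi> n)" for n
  proof -
    \<comment> \<open>Removing the integer \<open>\<nu>\<close> from \<open>\<theta>\<close> does
      not change the exponential, so the angle \<open>\<phi>\<close> may be taken in
      \<open>(0, pi)\<close>.\<close>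
    have "2 * pi * F (Suc n) = (2 * pi * F n + 2 * \<phi> n) + 2 * pi * \<nu>"
      by (simp add: \<phi>_def \<theta>_def algebra_simps)
    then show ?thesis
      unfolding E_def by (simp flip: cis_mult add: cis_multiple_2pi)
  qed
  have E_eq: "E n = (E (Suc n) - E n) * c n" if "a \<le> n" "n \<le> b" for n
  proof -
    have "cis (2 * \<phi> n) - 1 \<noteq> 0"
      unfolding cis_minus_one using sin_pos[OF that] by simp
    then show ?thesis by (simp add: E_Suc c_def field_simps)
  qed
  have k_antimono: "k (Suc n) \<le> k n" if "a \<le> n" "n < b" for n
  proof -
    have "0 < \<theta> n - \<nu>" "\<theta> (Suc n) - \<nu> < 1"
      using bounds[of n] bounds[of "Suc n"] that \<open>0 < \<delta>\<close> by auto
    then show ?thesis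
      unfolding k_def using mono[OF that] by (auto simp: \<phi>_def intro!: cot_antimono)
  qed
  \<comment> \<open>With the boundary term \<open>E (Suc m) * c m\<close> removed, each step adds an
    amount of norm \<open>k m - k (Suc m)\<close>; these telescope because \<open>k\<close> is
    decreasing.\<close>
  have "norm ((\<Sum>n=a..m. E n) - E (Suc m) * c m) \<le> norm (c a) + (k a - k m)"
    if "a \<le> m" "m \<le> b" for m
    using that
  proof (induction m rule: dec_induct)
    case base
    have "(\<Sum>n=a..a. E n) - E (Suc a) * c a = - (E a * c a)"
      using E_eq[of a] \<open>a \<le> b\<close> by (simp add: algebra_simps)
    then show ?case by (simp add: norm_mult E_def)
  next
    case (step m)
    have "(\<Sum>n=a..Suc m. E n) - E (Suc (Suc m)) * c (Suc m)
        = ((\<Sum>n=a..m. E n) - E (Suc m) * c m) + E (Suc m) * (c m - c (Suc m))"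
      using E_eq[of "Suc m"] step by (simp add: algebra_simps)
    also have "norm \<dots> \<le> (norm (c a) + (k a - k m)) + norm (E (Suc m) * (c m - c (Suc m)))"
      using step by (intro norm_triangle_le add_mono) auto
    also have "c m - c (Suc m) = \<i> * of_real (k (Suc m) - k m)"
      using c_eq[of m] c_eq[of "Suc m"] step by (simp add: complex_eq_iff)
    also have "norm (E (Suc m) * \<dots>) = k m - k (Suc m)"
      using k_antimono[of m] step by (simp add: norm_mult E_def del: of_real_diff)
    finally show ?case by simp
  qed
  from this[OF \<open>a \<le> b\<close> order_refl]
  have "norm (\<Sum>n=a..b. E n) \<le> norm (E (Suc b) * c b) + norm (c a) + (k a - k b)"
    using norm_triangle_sub[of "\<Sum>n=a..b. E n" "E (Suc b) * c b"] by simp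
  also have "norm (E (Suc b) * c b) = norm (c b)"
    by (simp add: norm_mult E_def)
  \<comment> \<open>Four quantities, \<open>norm (c a)\<close>, \<open>norm (c b)\<close>,
    \<open>k a\<close> and \<open>- k b\<close>, each at most
    \<open>1 / (4 * \<delta>)\<close>.\<close>
  also have "norm (c b) + norm (c a) + (k a - k b) \<le> 4 * (1 / (4 * \<delta>))"
    using norm_c[of a] norm_c[of b] abs_k[of a] abs_k[of b] \<open>a \<le> b\<close> by linarith
  finally show ?thesis by (simp add: E_def)
qed

section \<open>The second derivative test of van der Corput\<close>

text \<open>The extreme indices of \<open>A\<close> are at most \<open>\<delta> / \<mu>\<close>
  apart, since \<open>\<theta>\<close> gains at least \<open>\<mu>\<close> per index inside a window
  of length \<open>\<delta>\<close>. This counts the indices whose first difference lies near an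
  integer.\<close>

lemma card_le_spread:
  fixes \<theta> :: "nat \<Rightarrow> real"
  assumes "finite A" "0 < \<mu>" "0 \<le> \<delta>"
    and step: "\<And>m n. m \<in> A \<Longrightarrow> n \<in> A \<Longrightarrow> m \<le> n \<Longrightarrow> \<mu> * (real n - real m) \<le> \<theta> n - \<theta> m"
    and range: "\<And>n. n \<in> A \<Longrightarrow> u \<le> \<theta> n \<and> \<theta> n \<le> u + \<delta>"
  shows "real (card A) \<le> \<delta> / \<mu> + 1"
proof (cases "A = {}")
  case True
  then show ?thesis using assms by simp
next
  case False
  define p q where "p = Min A" and "q = Max A"
  have pq: "p \<in> A" "q \<in> A" "p \<le> q" "A \<subseteq> {p..q}"
    using False \<open>finite A\<close> by (auto simp: p_def q_def)
  have "card A \<le> Suc q - p"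
    using card_mono[OF _ pq(4)] by simp
  then have "real (card A) \<le> (real q - real p) + 1"
    using pq(3) by linarith
  moreover have "\<mu> * (real q - real p) \<le> \<delta>"
    using step[OF pq(1-3)] range[OF pq(1)] range[OF pq(2)] by linarith
  then have "real q - real p \<le> \<delta> / \<mu>"
    using \<open>0 < \<mu>\<close> by (simp add: field_simps)
  ultimately show ?thesis by linarith
qed

text \<open>
  Outside the \<open>\<delta>\<close>-neighbourhoods of the integers the first differences \<open>\<theta>\<close> fall under the
  Kusmin--Landau bound \<open>1/\<delta>\<close>, and each neighbourhood contains few indices because \<open>\<theta>\<close> grows by at
  least \<open>\<mu>\<close> per step; \<open>\<delta> = sqrt \<mu> / 2\<close> balances the two.
\<close>

lemma second_difference_test:
  fixes F \<theta> :: "nat \<Rightarrow> real"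
  defines "\<theta> \<equiv> \<lambda>n. F (Suc n) - F n"
  assumes "0 < \<mu>" "\<mu> \<le> 1" "0 \<le> C"
    and diff2: "\<And>n. a \<le> n \<Longrightarrow> Suc n < b \<Longrightarrow>
      \<mu> \<le> \<theta> (Suc n) - \<theta> n \<and> \<theta> (Suc n) - \<theta> n \<le> C * \<mu>"
  shows "norm (\<Sum>n=a..<b. cis (2 * pi * F n)) \<le> (C * \<mu> * real (b - a) + 2) * (5 / sqrt \<mu>)"
proof (cases "a < b")
  case False
  then show ?thesis using assms by simp
next
  case True
  define \<delta> where "\<delta> = sqrt \<mu> / 2"
  have \<delta>: "0 < \<delta>" "\<delta> \<le> 1/2" using assms by (auto simp: \<delta>_def)
  define E where "E n = cis (2 * pi * F n)" for n
  have growth: "\<mu> * (real n - real m) \<le> \<theta> n - \<theta> m \<and> \<theta> n - \<theta> m \<le> C * \<mu> * (real n - real m)"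
    if "a \<le> m" "m \<le> n" "n < b" for m n
    using that(2,3)
  proof (induction n rule: dec_induct)
    case base
    then show ?case by simp
  next
    case (step n)
    then show ?case using diff2[of n] \<open>a \<le> m\<close> by (auto simp: algebra_simps)
  qed
  have mono: "\<theta> m \<le> \<theta> n" if "a \<le> m" "m \<le> n" "n < b" for m n
  proof -
    have "0 \<le> \<mu> * (real n - real m)" using that \<open>0 < \<mu>\<close> by simp
    then show ?thesis using growth[OF that] by linarith
  qed
  define A where "A \<nu> = {n\<in>{a..<b}. \<lfloor>\<theta> n\<rfloor> = \<nu>}" for \<nu>
  define V where "V = {\<lfloor>\<theta> a\<rfloor>..\<lfloor>\<theta> (b - 1)\<rfloor>}"
  have A_bound: "norm (\<Sum>n\<in>A \<nu>. E n) \<le> 5 / sqrt \<mu>" for \<nu>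
  proof -
    define A1 A2 A3 where "A1 = {n\<in>A \<nu>. \<theta> n < \<nu> + \<delta>}"
      and "A2 = {n\<in>{a..<b}. \<nu> + \<delta> \<le> \<theta> n \<and> \<theta> n \<le> \<nu> + 1 - \<delta>}"
      and "A3 = {n\<in>A \<nu>. \<nu> + 1 - \<delta> < \<theta> n}"
    have fin: "finite A1" "finite A2" "finite A3"
      by (auto simp: A1_def A2_def A3_def A_def)
    have "A2 \<subseteq> A \<nu>"
      unfolding A2_def A_def using \<delta> by (auto simp: floor_eq_iff)
    then have A_eq: "A \<nu> = A1 \<union> (A2 \<union> A3)"
      by (auto simp: A1_def A2_def A3_def A_def)
    have "A1 \<inter> (A2 \<union> A3) = {}" "A2 \<inter> A3 = {}"
      using \<delta> by (auto simp: A1_def A2_def A3_def)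
    then have split: "(\<Sum>n\<in>A \<nu>. E n) = (\<Sum>n\<in>A1. E n) + ((\<Sum>n\<in>A2. E n) + (\<Sum>n\<in>A3. E n))"
      unfolding A_eq using fin by (simp add: sum.union_disjoint)
    have trivial: "norm (\<Sum>n\<in>X. E n) \<le> real (card X)" for X
      using sum_norm_le[of X E "\<lambda>_. 1"] by (simp add: E_def)
    have "real (card A1) \<le> \<delta> / \<mu> + 1"
      using fin \<delta> \<open>0 < \<mu>\<close> growth
      by (intro card_le_spread[where u = \<nu> and \<theta> = \<theta>])
         (auto simp: A1_def A_def floor_eq_iff)
    moreover have "real (card A3) \<le> \<delta> / \<mu> + 1"
      using fin \<delta> \<open>0 < \<mu>\<close> growth
      by (intro card_le_spread[where u = "\<nu> + 1 - \<delta>" and \<theta> = \<theta>])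
         (auto simp: A3_def A_def floor_eq_iff)
    moreover have "norm (\<Sum>n\<in>A2. E n) \<le> 1 / \<delta>"
    proof (cases "A2 = {}")
      case True
      then show ?thesis using \<delta> by simp
    next
      case False
      \<comment> \<open>As \<open>\<theta>\<close> is monotone, \<open>A2\<close> has no gaps, so
        Kusmin-Landau applies to it as a single interval.\<close>
      define p q where "p = Min A2" and "q = Max A2"
      have pq: "p \<in> A2" "q \<in> A2" "p \<le> q" "A2 \<subseteq> {p..q}"
        using False fin by (auto simp: p_def q_def)
      have sub: "n \<in> A2" if "p \<le> n" "n \<le> q" for n
        using mono[of p n] mono[of n q] pq that by (auto simp: A2_def)
      then have "A2 = {p..q}" using pq by auto
      moreover have "norm (\<Sum>n=p..q. cis (2 * pi * F n)) \<le> 1 / \<delta>"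
      proof (rule kusmin_landau[OF \<delta>(1) pq(3), of \<nu>])
        show "\<nu> + \<delta> \<le> F (Suc n) - F n \<and> F (Suc n) - F n \<le> \<nu> + 1 - \<delta>"
          if "p \<le> n" "n \<le> q" for n
          using sub[OF that] by (auto simp: A2_def \<theta>_def)
        show "F (Suc n) - F n \<le> F (Suc (Suc n)) - F (Suc n)" if "p \<le> n" "n < q" for n
          using mono[of n "Suc n"] pq that by (auto simp: A2_def \<theta>_def)
      qed
      ultimately show ?thesis by (simp add: E_def)
    qed
    ultimately have "norm (\<Sum>n\<in>A \<nu>. E n) \<le> 2 * (\<delta> / \<mu> + 1) + 1 / \<delta>"
      unfolding split using trivial[of A1] trivial[of A3]
      by (intro norm_triangle_le) (smt (verit) norm_triangle_ineq)
    also have "\<delta> / \<mu> = 1 / (2 * sqrt \<mu>)"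
      using \<open>0 < \<mu>\<close> by (simp add: \<delta>_def field_simps)
    also have "2 * (1 / (2 * sqrt \<mu>) + 1) + 1 / \<delta> = 3 / sqrt \<mu> + 2"
      using \<open>0 < \<mu>\<close> by (simp add: \<delta>_def field_simps)
    \<comment> \<open>\<open>\<mu> \<le> 1\<close> absorbs the extra indices:
      \<open>2 \<le> 2 / sqrt \<mu>\<close>.\<close>
    also have "\<dots> \<le> 5 / sqrt \<mu>"
      using \<open>0 < \<mu>\<close> \<open>\<mu> \<le> 1\<close> by (simp add: field_simps)
    finally show ?thesis .
  qed
  have "(\<Sum>n=a..<b. E n) = (\<Sum>\<nu>\<in>V. \<Sum>n\<in>A \<nu>. E n)"
    unfolding A_def
  proof (rule sum.group[symmetric])
    show "(\<lambda>n. \<lfloor>\<theta> n\<rfloor>) ` {a..<b} \<subseteq> V"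
      unfolding V_def using mono[of a] mono[of _ "b - 1"] by (auto intro!: floor_mono)
  qed (auto simp: V_def)
  also have "norm \<dots> \<le> real (card V) * (5 / sqrt \<mu>)"
    using sum_norm_le[of V "\<lambda>\<nu>. \<Sum>n\<in>A \<nu>. E n" "\<lambda>_. 5 / sqrt \<mu>"] A_bound by simp
  also have "\<dots> \<le> (C * \<mu> * real (b - a) + 2) * (5 / sqrt \<mu>)"
  proof (rule mult_right_mono)
    have "\<theta> (b - 1) - \<theta> a \<le> C * \<mu> * (real (b - 1) - real a)"
      using growth[of a "b - 1"] True by simp
    also have "\<dots> \<le> C * \<mu> * real (b - a)"
      using assms True by (intro mult_left_mono) auto
    finally have *: "\<theta> (b - 1) - \<theta> a \<le> C * \<mu> * real (b - a)" .
    have "\<lfloor>\<theta> a\<rfloor> \<le> \<lfloor>\<theta> (b - 1)\<rfloor>" using mono[of a "b - 1"] True by (intro floor_mono) auto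
    \<comment> \<open>The range of integer parts is no longer than the total growth of
      \<open>\<theta>\<close>; the \<open>2\<close> pays for rounding and for counting both
      ends.\<close>
    then have "real (card V) = real_of_int \<lfloor>\<theta> (b - 1)\<rfloor> - real_of_int \<lfloor>\<theta> a\<rfloor> + 1"
      unfolding V_def by simp
    then show "real (card V) \<le> C * \<mu> * real (b - a) + 2" using * by linarith
  qed (use \<open>0 < \<mu>\<close> in simp)
  finally show ?thesis by (simp add: E_def)
qed

text \<open>The second difference of the phase is exactly \<open>2 h y / (s (s + 1) (s + 2))\<close>
  with \<open>s = n + \<beta>\<close>. Within a block it stays between \<open>\<Lambda> / 6\<close>
  and \<open>2 \<Lambda>\<close>, so the second difference test applies with a bounded
  ratio.\<close>

lemma exp_sum_hyperbola:
  fixes y \<beta> c :: real and h K a b :: nat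
  assumes "0 < y" "0 \<le> \<beta>" "\<beta> \<le> 1" "1 \<le> h" "1 \<le> K" "K \<le> a" "b \<le> 2 * K"
  defines "\<Lambda> \<equiv> real h * (y / real K ^ 3)"
  shows "norm (\<Sum>n=a..<b. cis (2 * pi * (real h * (y / (real n + \<beta>) + c))))
    \<le> 120 * real K * sqrt \<Lambda> + 40 / sqrt \<Lambda>"
proof -
  define F where "F n = real h * (y / (real n + \<beta>) + c)" for n
  \<comment> \<open>The \<open>12\<close> comes from
    \<open>s (s + 1) (s + 2) \<le> (2 K) (2 K) (3 K)\<close>; then
    \<open>2 \<Lambda> = 24 \<mu>\<close> gives the ratio \<open>24\<close>.\<close>
  define \<mu> where "\<mu> = \<Lambda> / 12"
  have \<Lambda>: "0 < \<Lambda>" using assms by (simp add: \<Lambda>_def)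
  then have \<mu>: "0 < \<mu>" by (simp add: \<mu>_def)
  have len: "real (b - a) \<le> real K" using assms by simp
  have sq: "sqrt \<mu> \<le> sqrt \<Lambda>" "sqrt \<Lambda> \<le> 4 * sqrt \<mu>"
  proof -
    show "sqrt \<mu> \<le> sqrt \<Lambda>" using \<Lambda> by (simp add: \<mu>_def)
    have "sqrt \<Lambda> \<le> sqrt (16 * \<mu>)" using \<Lambda> by (simp add: \<mu>_def)
    then show "sqrt \<Lambda> \<le> 4 * sqrt \<mu>" by (simp add: real_sqrt_mult)
  qed
  show ?thesis
  proof (cases "\<mu> \<le> 1")
    \<comment> \<open>Here \<open>\<Lambda> > 12\<close>, and the trivial bound \<open>K\<close>
      already lies below the first term.\<close>
    case False
    have "norm (\<Sum>n=a..<b. cis (2 * pi * F n)) \<le> real (b - a)"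
      using sum_norm_le[of "{a..<b}" "\<lambda>n. cis (2 * pi * F n)" "\<lambda>_. 1"] by simp
    also have "\<dots> \<le> 120 * real K * 1" using len by simp
    also have "\<dots> \<le> 120 * real K * sqrt \<Lambda>"
      using False by (intro mult_left_mono) (auto simp: \<mu>_def)
    also have "\<dots> \<le> 120 * real K * sqrt \<Lambda> + 40 / sqrt \<Lambda>" using \<Lambda> by simp
    finally show ?thesis by (simp add: F_def)
  next
    case True
    have "norm (\<Sum>n=a..<b. cis (2 * pi * F n)) \<le> (24 * \<mu> * real (b - a) + 2) * (5 / sqrt \<mu>)"
    proof (rule second_difference_test[OF \<mu> True])
      fix n assume n: "a \<le> n" "Suc n < b"
      define s where "s = real n + \<beta>"
      have s: "real K \<le> s" "s + 1 \<le> 2 * real K" "0 < s" "1 \<le> real K"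
        using n assms by (auto simp: s_def)
      have F: "F n = real h * (y / s + c)" "F (Suc n) = real h * (y / (s + 1) + c)"
        "F (Suc (Suc n)) = real h * (y / (s + 2) + c)"
        by (simp_all add: F_def s_def algebra_simps)
      have "F (Suc (Suc n)) - F (Suc n) - (F (Suc n) - F n)
          = real h * y * (1 / (s + 2) - 2 / (s + 1) + 1 / s)"
        unfolding F by (simp add: divide_inverse algebra_simps)
      also have "1 / (s + 2) - 2 / (s + 1) + 1 / s = 2 / (s * (s + 1) * (s + 2))"
        using s by (simp add: divide_simps) (simp add: algebra_simps)
      finally have eq: "F (Suc (Suc n)) - F (Suc n) - (F (Suc n) - F n)
          = real h * y * (2 / (s * (s + 1) * (s + 2)))" .
      have lower: "real K * real K * real K \<le> s * (s + 1) * (s + 2)"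
        using s by (intro mult_mono) auto
      have upper: "s * (s + 1) * (s + 2) \<le> (2 * real K) * (2 * real K) * (3 * real K)"
        using s by (intro mult_mono) auto
      have hy: "0 \<le> real h * y" using assms by simp
      have "2 / (s * (s + 1) * (s + 2)) \<le> 2 / (real K ^ 3)"
        using lower s by (intro divide_left_mono) (auto simp: power3_eq_cube)
      note le = mult_left_mono[OF this hy]
      have "2 / (12 * real K ^ 3) \<le> 2 / (s * (s + 1) * (s + 2))"
        using upper s by (intro divide_left_mono) (auto simp: power3_eq_cube)
      note ge = mult_left_mono[OF this hy]
      from le ge
      show "\<mu> \<le> F (Suc (Suc n)) - F (Suc n) - (F (Suc n) - F n) \<and>
          F (Suc (Suc n)) - F (Suc n) - (F (Suc n) - F n) \<le> 24 * \<mu>"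
        unfolding eq using \<Lambda> by (simp add: \<mu>_def \<Lambda>_def mult_ac)
    qed simp
    also have "\<dots> \<le> (24 * \<mu> * real K + 2) * (5 / sqrt \<mu>)"
      using len \<mu> by (intro mult_right_mono add_right_mono mult_left_mono) auto
    also have "\<dots> = 120 * real K * (\<mu> / sqrt \<mu>) + 10 / sqrt \<mu>"
      by (simp add: algebra_simps add_divide_distrib)
    also have "\<mu> / sqrt \<mu> = sqrt \<mu>" using \<mu> by (simp add: real_div_sqrt)
    also have "120 * real K * sqrt \<mu> + 10 / sqrt \<mu> \<le> 120 * real K * sqrt \<Lambda> + 40 / sqrt \<Lambda>"
    proof (rule add_mono)
      show "10 / sqrt \<mu> \<le> 40 / sqrt \<Lambda>"
        using sq \<Lambda> \<mu> by (simp add: field_simps)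
    qed (use sq in \<open>auto intro!: mult_left_mono\<close>)
    finally show ?thesis by (simp add: F_def)
  qed
qed

section \<open>The sawtooth function\<close>

definition saw :: "real \<Rightarrow> real" where
  "saw t = frac t - 1 / 2"

text \<open>An antiderivative of the sawtooth: half the second periodic Bernoulli function, up to a constant.\<close>

definition bern :: "real \<Rightarrow> real" where
  "bern t = ((frac t)\<^sup>2 - frac t) / 2"

text \<open>Partial sums of the cosine series of \<open>2 pi^2 bern\<close>, up to an additive
  constant that drops out because only differences in \<open>t\<close> are compared with
  \<open>bern\<close>. The shift \<open>Suc h\<close> makes the frequencies run from
  \<open>1\<close> to \<open>N\<close>.\<close>

definition cosum :: "nat \<Rightarrow> real \<Rightarrow> real" where
  "cosum N t = (\<Sum>h<N. cos (2 * pi * (real (Suc h) * t)) / (real (Suc h))\<^sup>2)"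

section \<open>Fourier expansion of the second Bernoulli function\<close>

lemma dirichlet_kernel:
  "sin (pi * t) * (1 + 2 * (\<Sum>h<N. cos (2 * pi * (real (Suc h) * t)))) = sin ((2 * real N + 1) * (pi * t))"
proof (induction N)
  case 0
  then show ?case by simp
next
  case (Suc N)
  define u v where "u = pi * t" and "v = 2 * pi * (real (Suc N) * t)"
  have "sin (v + u) - sin (v - u) = 2 * sin u * cos v"
    by (simp add: sin_add sin_diff)
  moreover have "v + u = (2 * real (Suc N) + 1) * (pi * t)" "v - u = (2 * real N + 1) * (pi * t)"
    by (simp_all add: u_def v_def algebra_simps)
  ultimately have "sin ((2 * real (Suc N) + 1) * (pi * t)) =
      sin ((2 * real N + 1) * (pi * t)) + 2 * sin (pi * t) * cos (2 * pi * (real (Suc N) * t))"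
    by (simp add: u_def v_def)
  then show ?case
    unfolding Suc.IH[symmetric] by (simp add: algebra_simps)
qed

text \<open>The expression estimated is the derivative of \<open>cosum N t - pi^2 (t^2 - t)\<close>.
  Differentiated once more it becomes a multiple of the Dirichlet kernel, which does not decay but
  oscillates at rate \<open>2 N + 1\<close>; one integration by parts gains the inverse of that
  rate, uniformly away from the integers.\<close>

lemma cosum_tail_derivative:
  fixes N :: nat
  assumes "0 < \<epsilon>" "\<epsilon> \<le> t" "t \<le> 1 - \<epsilon>"
  shows "\<bar>- 2 * pi * (\<Sum>h<N. sin (2 * pi * (real (Suc h) * t)) / real (Suc h)) - pi\<^sup>2 * (2 * t - 1)\<bar>
    \<le> (2 * pi\<^sup>2 / (2 * \<epsilon>)\<^sup>2 + 2 * pi / (2 * \<epsilon>)) / (2 * real N + 1)"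
proof -
  define m where "m = 2 * real N + 1"
  have m: "1 \<le> m" by (simp add: m_def)
  define W1 where "W1 s = - 2 * pi * (\<Sum>h<N. sin (2 * pi * (real (Suc h) * s)) / real (Suc h)) - pi\<^sup>2 * (2 * s - 1)" for s
  \<comment> \<open>The subtracted term cancels the Dirichlet kernel in the derivative up to \<open>O(1/m)\<close>.\<close>
  define V where "V s = W1 s - 2 * pi * (cos (m * (pi * s)) / (m * sin (pi * s)))" for s
  define V' where "V' s = 2 * pi\<^sup>2 * (cos (m * (pi * s)) * cos (pi * s)) / (m * (sin (pi * s))\<^sup>2)" for s
  have sin_ge: "2 * \<epsilon> \<le> sin (pi * s)" if "s \<in> {\<epsilon>..1 - \<epsilon>}" for s
    using that assms by (intro sin_pi_ge) auto
  have deriv: "(V has_real_derivative V' s) (at s within {\<epsilon>..1 - \<epsilon>})" if s: "s \<in> {\<epsilon>..1 - \<epsilon>}" for s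
  proof -
    have pos: "0 < sin (pi * s)" using sin_ge[OF s] \<open>0 < \<epsilon>\<close> by linarith
    have "(W1 has_real_derivative (- 2 * pi * (\<Sum>h<N. 2 * pi * cos (2 * pi * (real (Suc h) * s))) - pi\<^sup>2 * 2)) (at s)"
      unfolding W1_def
      by (auto intro!: derivative_eq_intros sum.cong simp del: of_nat_Suc)
    also have "- 2 * pi * (\<Sum>h<N. 2 * pi * cos (2 * pi * (real (Suc h) * s))) - pi\<^sup>2 * 2
        = - 2 * pi\<^sup>2 * (1 + 2 * (\<Sum>h<N. cos (2 * pi * (real (Suc h) * s))))"
      by (simp add: sum_distrib_left[symmetric] power2_eq_square algebra_simps)
    also have "\<dots> = - 2 * pi\<^sup>2 * (sin (m * (pi * s)) / sin (pi * s))"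
      unfolding m_def dirichlet_kernel[symmetric] using pos by simp
    finally have W1: "(W1 has_real_derivative - 2 * pi\<^sup>2 * (sin (m * (pi * s)) / sin (pi * s))) (at s)" .
    have "((\<lambda>s. cos (m * (pi * s)) / (m * sin (pi * s))) has_real_derivative
        (- sin (m * (pi * s)) * (m * pi) * (m * sin (pi * s)) - cos (m * (pi * s)) * (m * (cos (pi * s) * pi)))
          / ((m * sin (pi * s)) * (m * sin (pi * s)))) (at s)"
      using pos m by (auto intro!: derivative_eq_intros)
    from DERIV_diff[OF W1 DERIV_cmult[OF this, of "2 * pi"]]
    have "(V has_real_derivative (- 2 * pi\<^sup>2 * (sin (m * (pi * s)) / sin (pi * s)) -
        2 * pi * ((- sin (m * (pi * s)) * (m * pi) * (m * sin (pi * s)) - cos (m * (pi * s)) * (m * (cos (pi * s) * pi)))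
          / ((m * sin (pi * s)) * (m * sin (pi * s)))))) (at s)"
      unfolding V_def .
    also have "(- 2 * pi\<^sup>2 * (sin (m * (pi * s)) / sin (pi * s)) -
        2 * pi * ((- sin (m * (pi * s)) * (m * pi) * (m * sin (pi * s)) - cos (m * (pi * s)) * (m * (cos (pi * s) * pi)))
          / ((m * sin (pi * s)) * (m * sin (pi * s))))) = V' s"
      unfolding V'_def using pos m by (simp add: field_simps power2_eq_square)
    finally show ?thesis by (rule has_field_derivative_at_within)
  qed
  have bound: "norm (V' s) \<le> 2 * pi\<^sup>2 / (m * (2 * \<epsilon>)\<^sup>2)" if s: "s \<in> {\<epsilon>..1 - \<epsilon>}" for s
  proof -
    have "\<bar>cos (m * (pi * s)) * cos (pi * s)\<bar> \<le> 1 * 1"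
      unfolding abs_mult by (intro mult_mono) auto
    then have "2 * pi\<^sup>2 * \<bar>cos (m * (pi * s)) * cos (pi * s)\<bar> / (m * (sin (pi * s))\<^sup>2)
        \<le> 2 * pi\<^sup>2 / (m * (2 * \<epsilon>)\<^sup>2)"
      using sin_ge[OF s] \<open>0 < \<epsilon>\<close> m
      by (intro frac_le mult_left_mono power_mono) auto
    then show ?thesis using m by (simp add: V'_def abs_mult)
  qed
  have half: "1/2 \<in> {\<epsilon>..1 - \<epsilon>}" and t: "t \<in> {\<epsilon>..1 - \<epsilon>}" using assms by auto
  have "norm (V t - V (1/2)) \<le> 2 * pi\<^sup>2 / (m * (2 * \<epsilon>)\<^sup>2) * norm (t - 1/2)"
    by (rule field_differentiable_bound[OF _ deriv bound t half]) auto
  also have "\<dots> \<le> 2 * pi\<^sup>2 / (m * (2 * \<epsilon>)\<^sup>2) * 1"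
    using assms m by (intro mult_left_mono) auto
  \<comment> \<open>The anchor \<open>1/2\<close> makes every piece vanish: the sines are taken at
    multiples of \<open>pi\<close>, the linear part is zero, and \<open>m\<close> is odd in
    \<open>cos (m * pi / 2)\<close>.\<close>
  also have "V (1/2) = 0"
  proof -
    have "sin (2 * pi * (real (Suc h) * (1/2))) = 0" for h
      using sin_npi[of "Suc h"] by (simp add: mult_ac del: of_nat_Suc)
    moreover have "cos (m * (pi * (1/2))) = 0"
      unfolding m_def cos_zero_iff_int by (intro exI[of _ "2 * int N + 1"]) simp
    ultimately show ?thesis unfolding V_def W1_def by (simp del: of_nat_Suc)
  qed
  finally have V: "\<bar>V t\<bar> \<le> 2 * pi\<^sup>2 / (m * (2 * \<epsilon>)\<^sup>2)" by simp
  have "\<bar>cos (m * (pi * t)) / (m * sin (pi * t))\<bar> \<le> 1 / (m * (2 * \<epsilon>))"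
    using sin_ge[OF t] \<open>0 < \<epsilon>\<close> m unfolding abs_divide abs_mult
    by (intro frac_le mult_mono) auto
  then have "\<bar>2 * pi * (cos (m * (pi * t)) / (m * sin (pi * t)))\<bar> \<le> 2 * pi * (1 / (m * (2 * \<epsilon>)))"
    unfolding abs_mult[of "2 * pi"] by (intro mult_mono) auto
  moreover have "\<bar>W1 t\<bar> \<le> \<bar>V t\<bar> + \<bar>2 * pi * (cos (m * (pi * t)) / (m * sin (pi * t)))\<bar>"
    using abs_triangle_ineq[of "V t" "2 * pi * (cos (m * (pi * t)) / (m * sin (pi * t)))"] by (simp add: V_def)
  ultimately have "\<bar>W1 t\<bar> \<le> 2 * pi\<^sup>2 / (m * (2 * \<epsilon>)\<^sup>2) + 2 * pi * (1 / (m * (2 * \<epsilon>)))"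
    using V by linarith
  also have "\<dots> = (2 * pi\<^sup>2 / (2 * \<epsilon>)\<^sup>2 + 2 * pi / (2 * \<epsilon>)) / m"
    using m by (simp add: add_divide_distrib mult.commute)
  finally show ?thesis unfolding W1_def m_def .
qed

text \<open>On a compact part of \<open>(0,1)\<close> containing both points, the mean value
  inequality turns the \<open>O(1/N)\<close> bound on the derivative into convergence. On the open
  unit interval \<open>pi^2 (t^2 - t)\<close> is \<open>2 pi^2 bern t\<close>.\<close>

lemma cosum_diff_interior:
  assumes "t \<in> {0<..<1}" "s \<in> {0<..<1}"
  shows "(\<lambda>N. cosum N t - cosum N s) \<longlonglongrightarrow> pi\<^sup>2 * (t\<^sup>2 - t) - pi\<^sup>2 * (s\<^sup>2 - s)"
proof -
  define \<epsilon> where "\<epsilon> = min (min t (1 - t)) (min s (1 - s))"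
  have \<epsilon>: "0 < \<epsilon>" "t \<in> {\<epsilon>..1 - \<epsilon>}" "s \<in> {\<epsilon>..1 - \<epsilon>}"
    using assms by (auto simp: \<epsilon>_def)
  define A where "A = 2 * pi\<^sup>2 / (2 * \<epsilon>)\<^sup>2 + 2 * pi / (2 * \<epsilon>)"
  have "norm ((cosum N t - cosum N s) - (pi\<^sup>2 * (t\<^sup>2 - t) - pi\<^sup>2 * (s\<^sup>2 - s))) \<le> A / (2 * real N + 1)" for N
  proof -
    define W where "W r = cosum N r - pi\<^sup>2 * (r\<^sup>2 - r)" for r
    define W1 where "W1 r = - 2 * pi * (\<Sum>h<N. sin (2 * pi * (real (Suc h) * r)) / real (Suc h)) - pi\<^sup>2 * (2 * r - 1)" for r
    have "A \<ge> 0" using \<epsilon> by (auto simp: A_def)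
    have deriv: "(W has_real_derivative W1 r) (at r)" for r
      unfolding W_def W1_def cosum_def
      by (auto intro!: derivative_eq_intros sum.cong simp: sum_distrib_left power2_eq_square sum_negf[symmetric] simp del: of_nat_Suc)
    have "norm (W t - W s) \<le> A / (2 * real N + 1) * norm (t - s)"
    proof (rule field_differentiable_bound[where S = "{\<epsilon>..1 - \<epsilon>}" and f' = W1])
      show "(W has_real_derivative W1 r) (at r within {\<epsilon>..1 - \<epsilon>})" for r
        using deriv by (rule has_field_derivative_at_within)
      show "norm (W1 r) \<le> A / (2 * real N + 1)" if "r \<in> {\<epsilon>..1 - \<epsilon>}" for r
        using cosum_tail_derivative[of \<epsilon> r N] that \<epsilon> by (simp add: W1_def A_def del: of_nat_Suc)
    qed (use \<epsilon> in auto)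
    also have "\<dots> \<le> A / (2 * real N + 1) * 1"
      using \<open>A \<ge> 0\<close> assms by (intro mult_left_mono) auto
    finally show ?thesis by (simp add: W_def algebra_simps)
  qed
  moreover have "(\<lambda>N. A / (2 * real N + 1)) \<longlonglongrightarrow> 0"
    by real_asymp
  ultimately have "(\<lambda>N. (cosum N t - cosum N s) - (pi\<^sup>2 * (t\<^sup>2 - t) - pi\<^sup>2 * (s\<^sup>2 - s))) \<longlonglongrightarrow> 0"
    by (rule Lim_null_comparison[OF always_eventually, rule_format])
  then show ?thesis by (rule LIM_zero_cancel)
qed

text \<open>Weierstrass M-test against \<open>1/h^2\<close>. Continuity of the limit is what later
  reaches the integers, where the bound on the derivative degenerates.\<close>

lemma cosum_limit:
  obtains C where "\<And>t. (\<lambda>N. cosum N t) \<longlonglongrightarrow> C t" "continuous_on UNIV C"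
proof -
  define C where "C t = (\<Sum>h. cos (2 * pi * (real (Suc h) * t)) / (real (Suc h))\<^sup>2)" for t
  have "summable (\<lambda>h. inverse ((real (Suc h))\<^sup>2))"
    unfolding summable_Suc_iff[of "\<lambda>n. inverse ((real n)\<^sup>2)"] by (rule inverse_power_summable) simp
  then have unif: "uniform_limit UNIV cosum C sequentially"
    unfolding cosum_def[abs_def] C_def[abs_def]
    by (intro Weierstrass_m_test) (auto simp: divide_inverse abs_mult simp del: of_nat_Suc intro!: mult_left_le_one_le)
  show ?thesis
  proof
    show "(\<lambda>N. cosum N t) \<longlonglongrightarrow> C t" for t
      using unif by (rule tendsto_uniform_limitI) simp
    show "continuous_on UNIV C"
      using unif
      by (rule uniform_limit_theorem[rotated]) (auto simp: cosum_def simp del: of_nat_Suc intro!: always_eventually continuous_intros)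
  qed
qed

lemma cosum_frac: "cosum N (frac t) = cosum N t"
proof -
  have "cos (2 * pi * (real (Suc h) * frac t)) = cos (2 * pi * (real (Suc h) * t))" for h
  proof -
    have "2 * pi * (real (Suc h) * frac t) = 2 * pi * (real (Suc h) * t) - 2 * pi * of_int (int (Suc h) * \<lfloor>t\<rfloor>)"
      by (simp add: frac_def algebra_simps)
    moreover have "cos (x - 2 * pi * of_int n) = cos x" for x n
      by (simp add: cos_diff)
    ultimately show ?thesis by (simp only:)
  qed
  then show ?thesis by (simp add: cosum_def)
qed

text \<open>The limit minus \<open>pi^2 (t^2 - t)\<close> is constant on the open unit interval, by
  continuity also on the closed one; periodicity carries the identity to the whole line.\<close>

lemma cosum_diff_tendsto_bern:
  "(\<lambda>N. cosum N t - cosum N s) \<longlonglongrightarrow> 2 * pi\<^sup>2 * (bern t - bern s)"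
proof -
  obtain C where C: "\<And>t. (\<lambda>N. cosum N t) \<longlonglongrightarrow> C t" "continuous_on UNIV C"
    using cosum_limit by blast
  define G where "G t = C t - pi\<^sup>2 * (t\<^sup>2 - t)" for t
  have G_int: "G r = G (1/2)" if "r \<in> {0<..<1}" for r
  proof -
    have "(\<lambda>N. cosum N r - cosum N (1/2)) \<longlonglongrightarrow> C r - C (1/2)"
      by (intro tendsto_diff C)
    moreover have "(\<lambda>N. cosum N r - cosum N (1/2)) \<longlonglongrightarrow> pi\<^sup>2 * (r\<^sup>2 - r) - pi\<^sup>2 * ((1/2)\<^sup>2 - 1/2)"
      using that by (intro cosum_diff_interior) auto
    ultimately have "C r - C (1/2) = pi\<^sup>2 * (r\<^sup>2 - r) - pi\<^sup>2 * ((1/2)\<^sup>2 - 1/2)"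
      by (rule LIMSEQ_unique)
    then show ?thesis unfolding G_def by linarith
  qed
  have G: "G r = G (1/2)" if "r \<in> {0..1}" for r
  proof (rule continuous_constant_on_closure[where S = "{0<..<1::real}" and f = G])
    show "continuous_on (closure {0<..<1}) G"
      unfolding G_def by (intro continuous_intros continuous_on_subset[OF C(2)]) auto
    show "r \<in> closure {0<..<1}" using that by (simp add: closure_greaterThanLessThan)
  qed (rule G_int)
  have "(\<lambda>N. cosum N (frac t) - cosum N (frac s)) \<longlonglongrightarrow> C (frac t) - C (frac s)"
    by (intro tendsto_diff C)
  also have "C (frac t) - C (frac s) = 2 * pi\<^sup>2 * (bern t - bern s)"
  proof -
    have "G (frac t) = G (frac s)"
      using G[of "frac t"] G[of "frac s"] frac_lt_1[of t] frac_lt_1[of s] by simp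
    then show ?thesis unfolding G_def bern_def right_diff_distrib diff_divide_distrib by simp
  qed
  finally show ?thesis by (simp add: cosum_frac)
qed

text \<open>
  Since the sawtooth only jumps downwards, averaging it over a window to the right or to the left
  bounds it from one side. Unlike the sawtooth, the averages have absolutely convergent Fourier series.
\<close>

lemma bern_forward:
  assumes "0 \<le> \<Delta>" "\<Delta> < 1"
  shows "bern (t + \<Delta>) - bern t \<le> \<Delta> * saw t + \<Delta>\<^sup>2 / 2"
proof -
  define f where "f = frac t"
  have f: "0 \<le> f" "f < 1" by (auto simp: f_def frac_lt_1)
  have \<Delta>: "frac \<Delta> = \<Delta>" using assms by (simp add: frac_eq)
  show ?thesis
  proof (cases "f + \<Delta> < 1")
    case True
    then have "frac (t + \<Delta>) = f + \<Delta>" by (simp add: frac_add f_def \<Delta>)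
    then show ?thesis
      by (simp add: bern_def saw_def f_def[symmetric] power2_eq_square field_simps)
  next
    \<comment> \<open>The window crosses an integer: the right side exceeds the left by
      \<open>f + \<Delta> - 1\<close>, the length lying beyond the integer.\<close>
    case False
    then have eq: "frac (t + \<Delta>) = f + \<Delta> - 1" by (simp add: frac_add f_def \<Delta>)
    then show ?thesis using False
      unfolding bern_def saw_def eq f_def[symmetric] by (simp add: power2_eq_square field_simps)
  qed
qed

lemma bern_backward:
  assumes "0 \<le> \<Delta>" "\<Delta> < 1"
  shows "\<Delta> * saw t - \<Delta>\<^sup>2 / 2 \<le> bern t - bern (t - \<Delta>)"
proof -
  define f where "f = frac (t - \<Delta>)"
  have f: "0 \<le> f" "f < 1" by (auto simp: f_def frac_lt_1)
  have \<Delta>: "frac \<Delta> = \<Delta>" using assms by (simp add: frac_eq)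
  have t: "t = (t - \<Delta>) + \<Delta>" by simp
  show ?thesis
  proof (cases "f + \<Delta> < 1")
    case True
    then have "frac t = f + \<Delta>" by (subst t, subst frac_add) (simp add: f_def \<Delta>)
    then show ?thesis
      by (simp add: bern_def saw_def f_def[symmetric] power2_eq_square field_simps)
  next
    \<comment> \<open>Across an integer the right side exceeds the left by \<open>1 - f\<close>, the
      length of the window before the integer.\<close>
    case False
    then have eq: "frac t = f + \<Delta> - 1" by (subst t, subst frac_add) (simp add: f_def \<Delta>)
    then show ?thesis using False f
      unfolding bern_def saw_def eq f_def[symmetric] by (simp add: power2_eq_square field_simps)
  qed
qed

section \<open>From exponential sums to sums of the sawtooth\<close>

text \<open>Shifting by \<open>s\<close> multiplies frequency \<open>h\<close> by
  \<open>e(h s) - 1\<close>, of size at most \<open>2 pi min(1, h |s|)\<close>, which damps the low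
  frequencies. As \<open>R\<close> does not depend on \<open>N\<close>, the bound survives the
  limit; dividing \<open>2 pi R\<close> by \<open>2 pi^2\<close> leaves
  \<open>R / pi\<close>.\<close>

lemma bern_sum_diff_bound:
  fixes t :: "'a \<Rightarrow> real"
  assumes W: "\<And>h::nat. 1 \<le> h \<Longrightarrow> norm (\<Sum>n\<in>I. cis (2 * pi * (real h * t n))) \<le> W h"
    and R: "\<And>N. (\<Sum>h=1..N. min 1 (real h * \<bar>s\<bar>) / (real h)\<^sup>2 * W h) \<le> R"
  shows "\<bar>\<Sum>n\<in>I. bern (t n + s) - bern (t n)\<bar> \<le> R / pi"
proof -
  have bound: "\<bar>\<Sum>n\<in>I. cosum N (t n + s) - cosum N (t n)\<bar> \<le> 2 * pi * R" for N
  proof -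
    define D where "D h = (\<Sum>n\<in>I. cis (2 * pi * (real h * t n)))" for h :: nat
    have "(\<Sum>n\<in>I. cosum N (t n + s) - cosum N (t n)) =
      (\<Sum>n\<in>I. \<Sum>h=1..N. (cos (2 * pi * (real h * (t n + s))) - cos (2 * pi * (real h * t n))) / (real h)\<^sup>2)"
      unfolding cosum_def One_nat_def sum.atLeast1_atMost_eq
      by (simp only: sum_subtractf diff_divide_distrib)
    also have "\<dots> = (\<Sum>h=1..N. \<Sum>n\<in>I. (cos (2 * pi * (real h * (t n + s))) - cos (2 * pi * (real h * t n))) / (real h)\<^sup>2)"
      by (rule sum.swap)
    also have "\<dots> = (\<Sum>h=1..N. Re ((cis (2 * (pi * (real h * s))) - 1) * D h) / (real h)\<^sup>2)"
    proof (rule sum.cong[OF refl])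
      fix h
      have "cos (2 * pi * (real h * (t n + s))) - cos (2 * pi * (real h * t n))
          = Re ((cis (2 * (pi * (real h * s))) - 1) * cis (2 * pi * (real h * t n)))" for n
      proof -
        have "2 * pi * (real h * (t n + s)) = 2 * (pi * (real h * s)) + 2 * pi * (real h * t n)"
          by (simp add: algebra_simps)
        then show ?thesis
          by (simp only: left_diff_distrib cis_mult mult_1 minus_complex.sel cis.sel)
      qed
      then show "(\<Sum>n\<in>I. (cos (2 * pi * (real h * (t n + s))) - cos (2 * pi * (real h * t n))) / (real h)\<^sup>2)
          = Re ((cis (2 * (pi * (real h * s))) - 1) * D h) / (real h)\<^sup>2"
        unfolding D_def sum_distrib_left Re_sum sum_divide_distrib by simp
    qed
    also have "\<bar>\<dots>\<bar> \<le> (\<Sum>h=1..N. 2 * pi * (min 1 (real h * \<bar>s\<bar>) / (real h)\<^sup>2 * W h))"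
    proof (rule order_trans[OF sum_abs sum_mono])
      fix h assume h: "h \<in> {1..N}"
      have "\<bar>sin (pi * (real h * s))\<bar> \<le> pi * min 1 (real h * \<bar>s\<bar>)"
      proof (cases "real h * \<bar>s\<bar> \<le> 1")
        case True
        then show ?thesis
          using abs_sin_x_le_abs_x[of "pi * (real h * s)"] by (simp add: abs_mult)
      next
        case False
        have "\<bar>sin (pi * (real h * s))\<bar> \<le> pi"
          using abs_sin_le_one[of "pi * (real h * s)"] pi_ge_two by linarith
        with False show ?thesis by simp
      qed
      then have "norm (cis (2 * (pi * (real h * s))) - 1) \<le> 2 * pi * min 1 (real h * \<bar>s\<bar>)"
        unfolding cis_minus_one by (simp add: norm_mult)
      moreover have "norm (D h) \<le> W h" using W h by (simp add: D_def)
      ultimately have "norm ((cis (2 * (pi * (real h * s))) - 1) * D h) \<le> 2 * pi * min 1 (real h * \<bar>s\<bar>) * W h"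
        unfolding norm_mult by (rule mult_mono) auto
      then have "\<bar>Re ((cis (2 * (pi * (real h * s))) - 1) * D h)\<bar> \<le> 2 * pi * min 1 (real h * \<bar>s\<bar>) * W h"
        using abs_Re_le_cmod order_trans by blast
      then show "\<bar>Re ((cis (2 * (pi * (real h * s))) - 1) * D h) / (real h)\<^sup>2\<bar>
          \<le> 2 * pi * (min 1 (real h * \<bar>s\<bar>) / (real h)\<^sup>2 * W h)"
        by (simp add: abs_divide divide_right_mono)
    qed
    also have "\<dots> \<le> 2 * pi * R"
      unfolding sum_distrib_left[symmetric] using R by (intro mult_left_mono) auto
    finally show ?thesis .
  qed
  have "(\<lambda>N. \<Sum>n\<in>I. cosum N (t n + s) - cosum N (t n)) \<longlonglongrightarrow> (\<Sum>n\<in>I. 2 * pi\<^sup>2 * (bern (t n + s) - bern (t n)))"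
    by (intro tendsto_sum cosum_diff_tendsto_bern)
  then have "\<bar>\<Sum>n\<in>I. 2 * pi\<^sup>2 * (bern (t n + s) - bern (t n))\<bar> \<le> 2 * pi * R"
    using bound by (intro LIMSEQ_le_const2[OF tendsto_rabs]) auto
  then have "2 * pi * (pi * \<bar>\<Sum>n\<in>I. bern (t n + s) - bern (t n)\<bar>) \<le> 2 * pi * R"
    by (simp add: sum_distrib_left[symmetric] abs_mult power2_eq_square mult.assoc)
  then show ?thesis by (simp add: field_simps)
qed

text \<open>The averages to the right and to the left enclose \<open>\<Delta> * saw\<close>. After
  division by \<open>\<Delta>\<close>, the defect \<open>\<Delta>^2 / 2\<close> per point becomes
  the first term and the Fourier part the second.\<close>

lemma saw_sum_smoothing:
  fixes t :: "'a \<Rightarrow> real"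
  assumes "0 < \<Delta>" "\<Delta> < 1"
    and W: "\<And>h::nat. 1 \<le> h \<Longrightarrow> norm (\<Sum>n\<in>I. cis (2 * pi * (real h * t n))) \<le> W h"
    and R: "\<And>N. (\<Sum>h=1..N. min 1 (real h * \<Delta>) / (real h)\<^sup>2 * W h) \<le> R"
  shows "\<bar>\<Sum>n\<in>I. saw (t n)\<bar> \<le> real (card I) * \<Delta> / 2 + R / (pi * \<Delta>)"
proof -
  let ?S = "\<Sum>n\<in>I. saw (t n)"
  have "\<bar>\<Sum>n\<in>I. bern (t n + \<Delta>) - bern (t n)\<bar> \<le> R / pi"
    using R \<open>0 < \<Delta>\<close> by (intro bern_sum_diff_bound[where W = W] W) auto
  moreover have "(\<Sum>n\<in>I. bern (t n + \<Delta>) - bern (t n)) \<le> (\<Sum>n\<in>I. \<Delta> * saw (t n) + \<Delta>\<^sup>2 / 2)"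
    using assms by (intro sum_mono bern_forward) auto
  moreover have "\<bar>\<Sum>n\<in>I. bern (t n + (- \<Delta>)) - bern (t n)\<bar> \<le> R / pi"
    using R \<open>0 < \<Delta>\<close> by (intro bern_sum_diff_bound[where W = W] W) auto
  moreover have "(\<Sum>n\<in>I. \<Delta> * saw (t n) - \<Delta>\<^sup>2 / 2) \<le> (\<Sum>n\<in>I. bern (t n) - bern (t n - \<Delta>))"
    using assms by (intro sum_mono bern_backward) auto
  ultimately have "\<bar>\<Delta> * ?S\<bar> \<le> real (card I) * \<Delta>\<^sup>2 / 2 + R / pi"
    by (simp add: sum.distrib sum_subtractf sum_distrib_left)
  also have "\<dots> = \<Delta> * (real (card I) * \<Delta> / 2 + R / (pi * \<Delta>))"
    using \<open>0 < \<Delta>\<close> by (simp add: power2_eq_square field_simps)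
  finally have "\<Delta> * \<bar>?S\<bar> \<le> \<Delta> * (real (card I) * \<Delta> / 2 + R / (pi * \<Delta>))"
    using \<open>0 < \<Delta>\<close> by (simp add: abs_mult)
  then show ?thesis using \<open>0 < \<Delta>\<close> by simp
qed

section \<open>Sums of the smoothing weights\<close>

lemma sum_inverse_sqrt_le: "(\<Sum>h=1..k. 1 / sqrt (real h)) \<le> 2 * sqrt (real k)"
proof (induction k)
  case 0
  then show ?case by simp
next
  case (Suc k)
  define a b where "a = sqrt (real k)" and "b = sqrt (real (Suc k))"
  have ab: "0 \<le> a" "a \<le> b" "0 < b" "b\<^sup>2 = a\<^sup>2 + 1" by (auto simp: a_def b_def)
  have "1 = (b - a) * (b + a)" using ab(4) by (simp add: power2_eq_square algebra_simps)
  also have "\<dots> \<le> (b - a) * (2 * b)" using ab by (intro mult_left_mono) auto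
  finally have "1 / b \<le> 2 * b - 2 * a" using ab by (simp add: field_simps)
  with Suc.IH show ?case by (simp add: a_def b_def)
qed

text \<open>Telescoping with \<open>- 2 / sqrt t\<close>, the antiderivative of
  \<open>t^(-3/2)\<close>, replaces the comparison with an integral.\<close>

lemma sum_inverse_three_halves_le:
  assumes "1 \<le> k"
  shows "(\<Sum>h=Suc k..N. sqrt (real h) / (real h)\<^sup>2) \<le> 2 / sqrt (real k)"
proof -
  have telescope: "sqrt (real (Suc n)) / (real (Suc n))\<^sup>2 \<le> 2 / sqrt (real n) - 2 / sqrt (real (Suc n))"
    if "1 \<le> n" for n
  proof -
    define a b where "a = sqrt (real n)" and "b = sqrt (real (Suc n))"
    have ab: "0 < a" "a \<le> b" "0 < b" "b\<^sup>2 = a\<^sup>2 + 1" using that by (auto simp: a_def b_def)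
    have "(real (Suc n))\<^sup>2 = b * (b * (b * b))" by (simp add: b_def power2_eq_square del: of_nat_Suc)
    then have "sqrt (real (Suc n)) / (real (Suc n))\<^sup>2 = 1 / (b * (b * b))"
      using ab by (simp add: b_def[symmetric] del: of_nat_Suc)
    also have "\<dots> \<le> 2 / (a * b * (a + b))"
    proof -
      have "a * b * (a + b) \<le> b * b * (b + b)" using ab by (intro mult_mono) auto
      then have "2 / (b * b * (b + b)) \<le> 2 / (a * b * (a + b))"
        using ab by (intro divide_left_mono mult_pos_pos) auto
      moreover have "2 / (b * b * (b + b)) = 1 / (b * (b * b))"
        using ab by (simp add: field_simps)
      ultimately show ?thesis by linarith
    qed
    also have "\<dots> = 2 * ((b - a) * (a + b)) / (a * b * (a + b))"
      using ab by (simp add: power2_eq_square algebra_simps)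
    also have "\<dots> = 2 * (b - a) / (a * b)" using ab by simp
    also have "\<dots> = 2 / a - 2 / b" using ab by (simp add: field_simps)
    finally show ?thesis by (simp add: a_def b_def)
  qed
  show ?thesis
  proof (cases "k \<le> N")
    case False
    then show ?thesis by simp
  next
    case True
    have "(\<Sum>h=Suc k..N. sqrt (real h) / (real h)\<^sup>2) \<le> 2 / sqrt (real k) - 2 / sqrt (real N)"
      using True
    proof (induction N rule: dec_induct)
      case base
      then show ?case by simp
    next
      case (step n)
      have "(\<Sum>h=Suc k..Suc n. sqrt (real h) / (real h)\<^sup>2) =
          (\<Sum>h=Suc k..n. sqrt (real h) / (real h)\<^sup>2) + sqrt (real (Suc n)) / (real (Suc n))\<^sup>2"
        using step.hyps by (simp add: sum.cl_ivl_Suc)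
      moreover have "1 \<le> n" using step.hyps assms by simp
      ultimately show ?case using step.IH telescope[of n] by linarith
    qed
    then show ?thesis by (smt (verit) divide_nonneg_nonneg real_sqrt_ge_zero of_nat_0_le_iff)
  qed
qed

text \<open>The minimum changes at \<open>h = 1 / \<Delta>\<close>: up to there the terms are
  \<open>\<Delta> h^(-1/2)\<close>, beyond it \<open>h^(-3/2)\<close>. Both parts are of order
  \<open>sqrt \<Delta>\<close>, with constants \<open>2\<close> and
  \<open>2 sqrt 2 \<le> 3\<close>.\<close>

lemma smoothing_weight_sqrt:
  assumes "0 < \<Delta>" "\<Delta> \<le> 1"
  shows "(\<Sum>h=1..N. min 1 (real h * \<Delta>) / (real h)\<^sup>2 * sqrt (real h)) \<le> 5 * sqrt \<Delta>"
proof -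
  define k where "k = nat \<lfloor>1 / \<Delta>\<rfloor>"
  define w where "w h = min 1 (real h * \<Delta>) / (real h)\<^sup>2 * sqrt (real h)" for h :: nat
  have "1 \<le> 1 / \<Delta>" using assms by simp
  then have k: "1 \<le> k" "real k \<le> 1 / \<Delta>" "1 / \<Delta> < real k + 1"
    unfolding k_def by linarith+
  have w_small: "w h \<le> \<Delta> * (1 / sqrt (real h))" if "1 \<le> h" for h
  proof -
    have "w h \<le> real h * \<Delta> / (real h)\<^sup>2 * sqrt (real h)"
      unfolding w_def by (intro mult_right_mono divide_right_mono) auto
    also have "\<dots> = \<Delta> * (sqrt (real h) / real h)"
      using that by (simp add: power2_eq_square)
    also have "sqrt (real h) / real h = 1 / sqrt (real h)"
      by (simp add: sqrt_divide_self_eq inverse_eq_divide)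
    finally show ?thesis .
  qed
  have w_large: "w h \<le> sqrt (real h) / (real h)\<^sup>2" for h
  proof -
    have "w h \<le> 1 / (real h)\<^sup>2 * sqrt (real h)"
      unfolding w_def by (intro mult_right_mono divide_right_mono) auto
    then show ?thesis by simp
  qed
  have w_nonneg: "0 \<le> w h" for h using assms by (simp add: w_def)
  have "(\<Sum>h=1..N. w h) \<le> (\<Sum>h\<in>{1..k} \<union> {Suc k..N}. w h)"
    by (intro sum_mono2 w_nonneg) auto
  also have "\<dots> = (\<Sum>h=1..k. w h) + (\<Sum>h=Suc k..N. w h)"
    by (intro sum.union_disjoint) auto
  also have "(\<Sum>h=1..k. w h) \<le> (\<Sum>h=1..k. \<Delta> * (1 / sqrt (real h)))"
    by (intro sum_mono w_small) auto
  also have "\<dots> \<le> \<Delta> * (2 * sqrt (real k))"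
    unfolding sum_distrib_left[symmetric] using assms by (intro mult_left_mono sum_inverse_sqrt_le) auto
  also have "\<dots> \<le> \<Delta> * (2 * sqrt (1 / \<Delta>))"
    using k assms by (intro mult_left_mono real_sqrt_le_mono) auto
  also have "\<dots> = 2 * (\<Delta> / sqrt \<Delta>)" by (simp add: real_sqrt_divide)
  also have "\<Delta> / sqrt \<Delta> = sqrt \<Delta>" using assms by (simp add: real_div_sqrt)
  also have "(\<Sum>h=Suc k..N. w h) \<le> (\<Sum>h=Suc k..N. sqrt (real h) / (real h)\<^sup>2)"
    by (intro sum_mono w_large)
  also have "\<dots> \<le> 2 / sqrt (real k)" using k by (intro sum_inverse_three_halves_le) auto
  \<comment> \<open>From \<open>1 / \<Delta> < k + 1 \<le> 2 k\<close>.\<close>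
  also have "\<dots> \<le> 2 / sqrt (1 / (2 * \<Delta>))"
  proof -
    have "1 / (2 * \<Delta>) \<le> real k"
    proof -
      have "1 / \<Delta> \<le> 2 * real k" using k by linarith
      then show ?thesis using assms by (simp add: field_simps)
    qed
    then show ?thesis using assms k by (intro divide_left_mono mult_pos_pos) auto
  qed
  also have "\<dots> = 2 * sqrt 2 * sqrt \<Delta>"
    by (simp add: real_sqrt_divide real_sqrt_mult)
  also have "2 * sqrt 2 * sqrt \<Delta> \<le> 3 * sqrt \<Delta>"
  proof (rule mult_right_mono)
    have "sqrt 2 \<le> sqrt ((3/2)\<^sup>2)" by (intro real_sqrt_le_mono) (simp add: power2_eq_square)
    then show "2 * sqrt 2 \<le> 3" by simp
  qed (use assms in simp)
  finally show ?thesis by (simp add: w_def)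
qed

text \<open>Bounding the minimum by \<open>h \<Delta>\<close> for every \<open>h\<close> is good
  enough here: what remains is the sum of \<open>h^(-3/2)\<close>, at most \<open>3\<close>.\<close>

lemma smoothing_weight_inverse_sqrt:
  assumes "0 < \<Delta>"
  shows "(\<Sum>h=1..N. min 1 (real h * \<Delta>) / (real h)\<^sup>2 * (1 / sqrt (real h))) \<le> 3 * \<Delta>"
proof -
  have "(\<Sum>h=1..N. min 1 (real h * \<Delta>) / (real h)\<^sup>2 * (1 / sqrt (real h)))
      \<le> (\<Sum>h=1..N. \<Delta> * (sqrt (real h) / (real h)\<^sup>2))"
  proof (rule sum_mono)
    fix h assume h: "h \<in> {1..N}"
    have "min 1 (real h * \<Delta>) / (real h)\<^sup>2 * (1 / sqrt (real h))
        \<le> real h * \<Delta> / (real h)\<^sup>2 * (1 / sqrt (real h))"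
      by (intro mult_right_mono divide_right_mono) auto
    also have "\<dots> = \<Delta> * ((real h / sqrt (real h)) / (real h)\<^sup>2)" by (simp add: mult_ac)
    also have "real h / sqrt (real h) = sqrt (real h)" by (simp add: real_div_sqrt)
    finally show "min 1 (real h * \<Delta>) / (real h)\<^sup>2 * (1 / sqrt (real h))
        \<le> \<Delta> * (sqrt (real h) / (real h)\<^sup>2)" .
  qed
  also have "\<dots> = \<Delta> * (\<Sum>h=1..N. sqrt (real h) / (real h)\<^sup>2)"
    by (rule sum_distrib_left[symmetric])
  also have "(\<Sum>h=1..N. sqrt (real h) / (real h)\<^sup>2) \<le> (\<Sum>h\<in>{1} \<union> {Suc 1..N}. sqrt (real h) / (real h)\<^sup>2)"
    by (intro sum_mono2) auto
  also have "\<dots> = 1 + (\<Sum>h=Suc 1..N. sqrt (real h) / (real h)\<^sup>2)"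
    by (subst sum.union_disjoint) auto
  also have "\<dots> \<le> 1 + 2"
    using sum_inverse_three_halves_le[of 1 N] by simp
  finally show ?thesis using assms by simp
qed

section \<open>Sawtooth sums along hyperbolas\<close>

lemma abs_saw_le: "\<bar>saw t\<bar> \<le> 1 / 2"
  using frac_ge_0[of t] frac_lt_1[of t] unfolding saw_def by linarith

text \<open>The smoothing width is \<open>u = \<mu>\<^sup>1\<^sup>/\<^sup>3\<close>, where \<open>\<mu> = Y\<^sup>3/K\<^sup>3\<close> is the size of the second derivative.\<close>

lemma saw_sum_block:
  fixes Y \<beta> c :: real and K a b :: nat
  assumes "0 < Y" "0 \<le> \<beta>" "\<beta> \<le> 1" "1 \<le> K" "K \<le> a" "b \<le> 2 * K"
  shows "\<bar>\<Sum>n=a..<b. saw (Y ^ 3 / (real n + \<beta>) + c)\<bar> \<le> 250 * (Y + sqrt (real K ^ 3 / Y ^ 3))"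
proof -
  define u where "u = Y / real K"
  have u: "0 < u" using assms by (simp add: u_def)
  have Y: "Y = u * real K" using assms by (simp add: u_def)
  have len: "real (b - a) \<le> real K" using assms by simp
  have sqrt_nonneg: "0 \<le> sqrt (real K ^ 3 / Y ^ 3)" using assms by simp
  show ?thesis
  proof (cases "u < 1")
    \<comment> \<open>Then \<open>K \<le> Y\<close>, and the trivial bound suffices.\<close>
    case False
    have "\<bar>\<Sum>n=a..<b. saw (Y ^ 3 / (real n + \<beta>) + c)\<bar> \<le> (\<Sum>n=a..<b. 1 / 2)"
      by (rule order_trans[OF sum_abs sum_mono]) (rule abs_saw_le)
    also have "\<dots> \<le> real K" using len by simp
    also have "\<dots> \<le> Y" using False assms by (simp add: u_def field_simps)
    also have "\<dots> \<le> 250 * (Y + sqrt (real K ^ 3 / Y ^ 3))" using sqrt_nonneg assms by simp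
    finally show ?thesis .
  next
    case True
    \<comment> \<open>\<open>v^2\<close> is the size of the second derivative at frequency
      \<open>1\<close>, so \<open>W\<close> below is the exponential sum bound with its dependence
      on \<open>h\<close> separated.\<close>
    define v where "v = sqrt (u ^ 3)"
    have v: "0 < v" using u by (simp add: v_def)
    have u3: "Y ^ 3 / real K ^ 3 = u ^ 3" by (simp add: u_def power_divide)
    define W where "W h = 120 * real K * v * sqrt (real h) + 40 / v * (1 / sqrt (real h))" for h :: nat
    have W: "norm (\<Sum>n=a..<b. cis (2 * pi * (real h * (Y ^ 3 / (real n + \<beta>) + c)))) \<le> W h" if "1 \<le> h" for h
      using exp_sum_hyperbola[of "Y ^ 3" \<beta> h K a b c] that assms
      unfolding u3 W_def v_def by (simp add: real_sqrt_mult mult_ac)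
    have vu: "v * sqrt u = u\<^sup>2"
    proof -
      have "u ^ 3 * u = (u\<^sup>2)\<^sup>2" by (simp add: power2_eq_square power3_eq_cube)
      then show ?thesis by (simp only: v_def real_sqrt_mult[symmetric] real_sqrt_abs) simp
    qed
    have R: "(\<Sum>h=1..N. min 1 (real h * u) / (real h)\<^sup>2 * W h) \<le> 600 * real K * u\<^sup>2 + 120 / v * u" for N
    proof -
      have "(\<Sum>h=1..N. min 1 (real h * u) / (real h)\<^sup>2 * W h) =
          120 * real K * v * (\<Sum>h=1..N. min 1 (real h * u) / (real h)\<^sup>2 * sqrt (real h))
          + 40 / v * (\<Sum>h=1..N. min 1 (real h * u) / (real h)\<^sup>2 * (1 / sqrt (real h)))"
        unfolding W_def sum_distrib_left sum.distrib[symmetric]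
        by (rule sum.cong) (simp_all only: distrib_left mult_ac)
      also have "\<dots> \<le> 120 * real K * v * (5 * sqrt u) + 40 / v * (3 * u)"
        using u v True
        by (intro add_mono mult_left_mono smoothing_weight_sqrt smoothing_weight_inverse_sqrt) auto
      also have "120 * real K * v * (5 * sqrt u) = 600 * real K * (v * sqrt u)" by simp
      finally show ?thesis by (simp add: vu)
    qed
    \<comment> \<open>Since \<open>Y = u K\<close>, the smoothing loss is at most
      \<open>Y / 2\<close> and the term with \<open>u^2\<close> becomes \<open>600 Y / pi\<close>;
      the last one is a multiple of \<open>1 / v = sqrt (K^3 / Y^3)\<close>.\<close>
    have "\<bar>\<Sum>n=a..<b. saw (Y ^ 3 / (real n + \<beta>) + c)\<bar>
        \<le> real (card {a..<b}) * u / 2 + (600 * real K * u\<^sup>2 + 120 / v * u) / (pi * u)"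
      by (rule saw_sum_smoothing[OF u True W R])
    also have "(600 * real K * u\<^sup>2 + 120 / v * u) / (pi * u) = (600 * Y + 120 / v) / pi"
      using u by (simp add: Y power2_eq_square field_simps)
    also have "\<dots> \<le> (600 * Y + 120 / v) / 3"
      using pi_gt3 assms v by (intro divide_left_mono) auto
    also have "real (card {a..<b}) * u / 2 \<le> Y / 2"
      using len u by (simp add: Y mult.commute mult_left_mono)
    also have "120 / v = 120 * sqrt (real K ^ 3 / Y ^ 3)"
    proof -
      have "real K ^ 3 / Y ^ 3 = 1 / u ^ 3" unfolding u3[symmetric] by simp
      then show ?thesis by (simp add: v_def real_sqrt_divide)
    qed
    also have "Y / 2 + (600 * Y + 120 * sqrt (real K ^ 3 / Y ^ 3)) / 3 \<le> 250 * (Y + sqrt (real K ^ 3 / Y ^ 3))"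
    proof -
      have "y / 2 + (600 * y + 120 * s) / 3 \<le> 250 * (y + s)" if "0 \<le> y" "0 \<le> s" for y s :: real
        using that by (simp add: add_divide_distrib)
      then show ?thesis using assms sqrt_nonneg by simp
    qed
    finally show ?thesis by simp
  qed
qed

text \<open>Peel off the top dyadic block \<open>[2^j, X']\<close> and induct on \<open>j\<close>.
  The block bound grows with \<open>K \<le> X\<close>, so one \<open>B\<close> serves all
  \<open>J\<close> blocks.\<close>

lemma saw_sum_prefix:
  fixes Y \<beta> c :: real and X J :: nat
  assumes "0 < Y" "0 \<le> \<beta>" "\<beta> \<le> 1" "X < 2 ^ J"
  shows "\<bar>\<Sum>n=1..X. saw (Y ^ 3 / (real n + \<beta>) + c)\<bar> \<le> real J * (250 * (Y + sqrt (real X ^ 3 / Y ^ 3)))"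
proof -
  define B where "B = 250 * (Y + sqrt (real X ^ 3 / Y ^ 3))"
  define s where "s n = saw (Y ^ 3 / (real n + \<beta>) + c)" for n
  have B: "0 \<le> B" using assms by (simp add: B_def)
  have "\<bar>\<Sum>n=1..X'. s n\<bar> \<le> real j * B" if "X' < 2 ^ j" "X' \<le> X" for X' j
    using that
  proof (induction j arbitrary: X')
    case 0
    then show ?case by simp
  next
    case (Suc j)
    show ?case
    proof (cases "X' < 2 ^ j")
      case True
      with Suc.IH[of X'] Suc.prems have "\<bar>\<Sum>n=1..X'. s n\<bar> \<le> real j * B" by simp
      then show ?thesis using B by (simp add: algebra_simps)
    next
      case False
      define K :: nat where "K = 2 ^ j"
      have K: "1 \<le> K" "K \<le> X'" "Suc X' \<le> 2 * K" using False Suc.prems by (auto simp: K_def)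
      have "{1..X'} = {1..K - 1} \<union> {K..<Suc X'}" "{1..K - 1} \<inter> {K..<Suc X'} = {}" using K by auto
      then have "(\<Sum>n=1..X'. s n) = (\<Sum>n=1..K - 1. s n) + (\<Sum>n=K..<Suc X'. s n)"
        by (simp only: sum.union_disjoint[OF finite_atLeastAtMost finite_atLeastLessThan])
      moreover have "\<bar>\<Sum>n=1..K - 1. s n\<bar> \<le> real j * B"
        using K Suc.prems by (intro Suc.IH) (auto simp: K_def[symmetric])
      moreover have "\<bar>\<Sum>n=K..<Suc X'. s n\<bar> \<le> B"
      proof -
        have "\<bar>\<Sum>n=K..<Suc X'. s n\<bar> \<le> 250 * (Y + sqrt (real K ^ 3 / Y ^ 3))"
          unfolding s_def using K assms by (intro saw_sum_block) auto
        also have "\<dots> \<le> B"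
          unfolding B_def using K Suc.prems assms
          by (intro mult_left_mono add_left_mono real_sqrt_le_mono divide_right_mono power_mono) auto
        finally show ?thesis .
      qed
      ultimately show ?thesis by (simp add: algebra_simps)
    qed
  qed
  from this[OF assms(4) order_refl] show ?thesis by (simp add: s_def B_def)
qed

text \<open>A difference of two prefixes, whence the doubled constant.\<close>

lemma saw_sum_interval:
  fixes Y \<beta> c :: real and X0 X J :: nat
  assumes "0 < Y" "0 \<le> \<beta>" "\<beta> \<le> 1" "X < 2 ^ J"
  shows "\<bar>\<Sum>n\<in>{X0<..X}. saw (Y ^ 3 / (real n + \<beta>) + c)\<bar> \<le> real J * (500 * (Y + sqrt (real X ^ 3 / Y ^ 3)))"
proof (cases "X0 \<le> X")
  case False
  then show ?thesis using assms by simp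
next
  case True
  define s where "s n = saw (Y ^ 3 / (real n + \<beta>) + c)" for n
  have "{1..X} = {1..X0} \<union> {X0<..X}" using True by auto
  then have "(\<Sum>n=1..X. s n) = (\<Sum>n=1..X0. s n) + (\<Sum>n\<in>{X0<..X}. s n)"
    by (simp only:) (subst sum.union_disjoint; auto)
  note split = this
  define B where "B = real J * (250 * (Y + sqrt (real X ^ 3 / Y ^ 3)))"
  have "\<bar>\<Sum>n=1..X. s n\<bar> \<le> B"
    unfolding s_def B_def using assms by (intro saw_sum_prefix) auto
  moreover have "\<bar>\<Sum>n=1..X0. s n\<bar> \<le> B"
  proof -
    have "\<bar>\<Sum>n=1..X0. s n\<bar> \<le> real J * (250 * (Y + sqrt (real X0 ^ 3 / Y ^ 3)))"
      unfolding s_def using assms True by (intro saw_sum_prefix) auto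
    also have "\<dots> \<le> B"
      unfolding B_def using True assms
      by (intro mult_left_mono add_left_mono real_sqrt_le_mono divide_right_mono power_mono) auto
    finally show ?thesis .
  qed
  ultimately have "\<bar>\<Sum>n\<in>{X0<..X}. s n\<bar> \<le> 2 * B" using split by linarith
  then show ?thesis by (simp add: s_def B_def algebra_simps)
qed

section \<open>Divisor sums\<close>

text \<open>The \<open>h\<close> of the overview, kept as a quotient so that it matches the summands
  of the theorem literally.\<close>

definition quot :: "(nat \<Rightarrow> complex) \<Rightarrow> nat \<Rightarrow> complex" where
  "quot g m = id_conv g m / of_nat m"

text \<open>The involution \<open>d -> m div d\<close> of the divisors exchanges the two factors of
  the convolution, and division by \<open>m\<close> turns \<open>m div d\<close> into
  \<open>1/d\<close>.\<close>

lemma quot_eq_divisor_sum: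
  assumes "1 \<le> m"
  shows "quot g m = (\<Sum>d | d dvd m. g d / of_nat d)"
proof -
  have "id_conv g m = (\<Sum>d | d dvd m. of_nat (m div d) * g d)"
    unfolding id_conv_def using assms
    by (intro sum.reindex_bij_witness[where i = "\<lambda>d. m div d" and j = "\<lambda>d. m div d"])
       (auto simp: div_dvd_iff_mult elim!: dvdE)
  also have "\<dots> / of_nat m = (\<Sum>d | d dvd m. g d / of_nat d)"
    unfolding sum_divide_distrib
  proof (rule sum.cong[OF refl])
    fix d assume "d \<in> {d. d dvd m}"
    then obtain e where "m = d * e" by auto
    then show "of_nat (m div d) * g d / of_nat m = g d / of_nat d"
      using assms by (simp add: field_simps)
  qed
  finally show ?thesis by (simp add: quot_def)
qed

text \<open>The one interchange of summation behind every estimate. It is stated for arbitrary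
  \<open>q\<close> and \<open>w\<close> because it serves the quotients \<open>[x/n]\<close>, the
  integers \<open>m\<close> with sawtooth weights, the plain mean value, and a single
  \<open>m\<close>.\<close>

lemma sum_quot_swap:
  fixes q :: "'a \<Rightarrow> nat" and w :: "'a \<Rightarrow> complex"
  assumes "finite I" and q: "\<And>n. n \<in> I \<Longrightarrow> 1 \<le> q n \<and> q n \<le> L"
  shows "(\<Sum>n\<in>I. quot g (q n) * w n) = (\<Sum>d=1..L. g d / of_nat d * (\<Sum>n\<in>{n\<in>I. d dvd q n}. w n))"
proof -
  have "quot g (q n) * w n = (\<Sum>d=1..L. if d dvd q n then g d / of_nat d * w n else 0)" if "n \<in> I" for n
  proof -
    have "{d. d dvd q n} = {d\<in>{1..L}. d dvd q n}"
      using q[OF that] by (auto dest: dvd_imp_le intro: Suc_leI dvd_pos_nat)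
    then have "quot g (q n) * w n = (\<Sum>d\<in>{d\<in>{1..L}. d dvd q n}. g d / of_nat d * w n)"
      using quot_eq_divisor_sum[of "q n" g] q[OF that] by (simp add: sum_distrib_right)
    then show ?thesis by (simp only: sum.inter_filter[OF finite_atLeastAtMost])
  qed
  then have "(\<Sum>n\<in>I. quot g (q n) * w n)
      = (\<Sum>n\<in>I. \<Sum>d=1..L. if d dvd q n then g d / of_nat d * w n else 0)"
    by (intro sum.cong) auto
  also have "\<dots> = (\<Sum>d=1..L. \<Sum>n\<in>I. if d dvd q n then g d / of_nat d * w n else 0)"
    by (rule sum.swap)
  also have "\<dots> = (\<Sum>d=1..L. g d / of_nat d * (\<Sum>n\<in>{n\<in>I. d dvd q n}. w n))"
    using \<open>finite I\<close> by (simp add: sum.inter_filter[symmetric] sum_distrib_left)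
  finally show ?thesis .
qed

lemma sum_multiples:
  fixes w :: "nat \<Rightarrow> 'b :: comm_monoid_add"
  assumes "1 \<le> d"
  shows "(\<Sum>m\<in>{m\<in>{1..M}. d dvd m}. w m) = (\<Sum>k=1..M div d. w (d * k))"
  using assms
  by (intro sum.reindex_bij_witness[where i = "\<lambda>k. d * k" and j = "\<lambda>m. m div d"])
     (auto simp: div_le_mono less_eq_div_iff_mult_less_eq mult.commute elim!: dvdE intro: Suc_leI)

lemma sum_inverse_le_ln:
  assumes "1 \<le> m"
  shows "(\<Sum>d=1..m. 1 / real d) \<le> 1 + ln (real m)"
  using euler_mascheroni_sequence_decreasing[of 1 m] assms
  by (simp add: harm_def inverse_eq_divide)

lemma one_plus_ln_le_sqrt:
  assumes "1 \<le> m"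
  shows "1 + ln (real m) \<le> 2 * sqrt (real m)"
proof -
  have "ln (sqrt (real m)) \<le> sqrt (real m) - 1"
    using assms by (intro ln_le_minus_one) simp
  then show ?thesis using assms by (simp add: ln_sqrt)
qed

lemma sum_inverse_square_le:
  assumes "1 \<le> m" "m \<le> L"
  shows "(\<Sum>d=Suc m..L. 1 / (real d)\<^sup>2) \<le> 1 / real m - 1 / real L"
  using assms(2)
proof (induction L rule: dec_induct)
  case base
  then show ?case by simp
next
  case (step L)
  have "1 / (real (Suc L))\<^sup>2 \<le> 1 / (real L * real (Suc L))"
    using step.hyps assms by (intro divide_left_mono) (auto simp: power2_eq_square)
  also have "\<dots> = 1 / real L - 1 / real (Suc L)"
    using step.hyps assms by (simp add: field_simps)
  finally show ?case using step by (simp add: sum.cl_ivl_Suc)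
qed

text \<open>The mean value of \<open>f(m)/m\<close>.\<close>

definition dens :: "(nat \<Rightarrow> complex) \<Rightarrow> complex" where
  "dens g = (\<Sum>d. g (Suc d) / of_nat (Suc d) ^ 2)"

text \<open>One factor \<open>m\<close> of \<open>m^2 (m + 1)\<close> is absorbed by
  \<open>quot\<close>. The remaining \<open>1 / (m (m + 1))\<close> is, apart from sawtooth terms,
  the share of the \<open>n \<le> x\<close> with \<open>[x/n] = m\<close>.\<close>

definition main_series :: "(nat \<Rightarrow> complex) \<Rightarrow> complex" where
  "main_series g = (\<Sum>m. quot g (Suc m) / (of_nat (Suc m) * of_nat (Suc (Suc m))))"

section \<open>The integers with a given quotient\<close>

lemma le_nat_floor_iff: "0 \<le> t \<Longrightarrow> n \<le> nat \<lfloor>t\<rfloor> \<longleftrightarrow> real n \<le> t"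
  by (simp add: le_nat_iff le_floor_iff)

text \<open>Both \<open>a \<le> [x/b]\<close> and \<open>b \<le> [x/a]\<close> say
  \<open>a b \<le> x\<close>, so the roles of \<open>n\<close> and \<open>m\<close> can be
  exchanged.\<close>

lemma nat_floor_divide_eq_iff:
  assumes "0 \<le> x" "1 \<le> n" "1 \<le> m"
  shows "nat \<lfloor>x / real n\<rfloor> = m \<longleftrightarrow> nat \<lfloor>x / real (Suc m)\<rfloor> < n \<and> n \<le> nat \<lfloor>x / real m\<rfloor>"
proof -
  have swap: "a \<le> nat \<lfloor>x / real b\<rfloor> \<longleftrightarrow> b \<le> nat \<lfloor>x / real a\<rfloor>" if "1 \<le> a" "1 \<le> b" for a b
    using assms that by (simp add: le_nat_floor_iff field_simps)
  have "nat \<lfloor>x / real n\<rfloor> = m \<longleftrightarrow> m \<le> nat \<lfloor>x / real n\<rfloor> \<and> \<not> Suc m \<le> nat \<lfloor>x / real n\<rfloor>"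
    by auto
  also have "\<dots> \<longleftrightarrow> n \<le> nat \<lfloor>x / real m\<rfloor> \<and> \<not> n \<le> nat \<lfloor>x / real (Suc m)\<rfloor>"
    using swap[of m n] swap[of "Suc m" n] assms by simp
  finally show ?thesis by auto
qed

text \<open>The \<open>n\<close> with quotient \<open>m\<close> fill the interval
  \<open>([x/(m+1)], [x/m]]\<close>, whose length is a difference of two floors. Starting just above
  \<open>[x/(M+1)]\<close> makes the range a union of complete intervals of this kind.\<close>

lemma sum_floor_quotients:
  fixes \<phi> :: "nat \<Rightarrow> complex"
  assumes "0 \<le> x"
  shows "(\<Sum>n\<in>{nat \<lfloor>x / real (Suc M)\<rfloor><..nat \<lfloor>x\<rfloor>}. \<phi> (nat \<lfloor>x / real n\<rfloor>))
    = (\<Sum>m=1..M. \<phi> m * of_real (x / (real m * real (Suc m)) + (saw (x / real (Suc m)) - saw (x / real m))))"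
proof -
  define q where "q n = nat \<lfloor>x / real n\<rfloor>" for n
  define I where "I = {q (Suc M)<..nat \<lfloor>x\<rfloor>}"
  have anti: "q b \<le> q a" if "1 \<le> a" "a \<le> b" for a b
    unfolding q_def using assms that by (intro nat_mono floor_mono divide_left_mono) auto
  have image: "q ` I \<subseteq> {1..M}"
  proof
    fix m assume "m \<in> q ` I"
    then obtain n where n: "n \<in> I" "m = q n" by auto
    have "1 \<le> n" "n \<le> nat \<lfloor>x\<rfloor>" "q (Suc M) < n" using n(1) by (auto simp: I_def)
    have "1 \<le> m"
      unfolding n(2) q_def using \<open>1 \<le> n\<close> \<open>n \<le> nat \<lfloor>x\<rfloor>\<close> assms
      by (subst le_nat_floor_iff) (auto simp: le_nat_floor_iff)
    moreover have "m \<le> M"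
    proof (rule ccontr)
      assume "\<not> m \<le> M"
      then have "real (Suc M) \<le> x / real n"
        using assms unfolding n(2) q_def by (subst le_nat_floor_iff[symmetric]) auto
      then have "n \<le> q (Suc M)"
        using assms \<open>1 \<le> n\<close> unfolding q_def by (simp add: le_nat_floor_iff field_simps)
      with \<open>q (Suc M) < n\<close> show False by simp
    qed
    ultimately show "m \<in> {1..M}" by simp
  qed
  have fiber: "real (card {n\<in>I. q n = m}) = x / (real m * real (Suc m)) + (saw (x / real (Suc m)) - saw (x / real m))"
    if m: "m \<in> {1..M}" for m
  proof -
    have "{n\<in>I. q n = m} = {q (Suc m)<..q m}"
    proof (intro set_eqI iffI)
      fix n assume "n \<in> {n\<in>I. q n = m}"
      then show "n \<in> {q (Suc m)<..q m}"
        using nat_floor_divide_eq_iff[OF assms, of n m] m by (auto simp: q_def I_def)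
    next
      fix n assume "n \<in> {q (Suc m)<..q m}"
      moreover from this have "1 \<le> n" by auto
      moreover have "q (Suc M) \<le> q (Suc m)" "q m \<le> q 1" using m by (auto intro: anti)
      ultimately show "n \<in> {n\<in>I. q n = m}"
        using nat_floor_divide_eq_iff[OF assms, of n m] m by (auto simp: q_def I_def)
    qed
    then have "real (card {n\<in>I. q n = m}) = real (q m) - real (q (Suc m))"
      using anti[of m "Suc m"] m by simp
    also have "\<dots> = of_int \<lfloor>x / real m\<rfloor> - of_int \<lfloor>x / real (Suc m)\<rfloor>"
      using assms by (simp add: q_def del: of_nat_Suc)
    also have "\<dots> = (x / real m - x / real (Suc m)) + (saw (x / real (Suc m)) - saw (x / real m))"
      by (simp add: saw_def frac_def del: of_nat_Suc)
    also have "x / real m - x / real (Suc m) = x / (real m * real (Suc m))"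
      using m by (simp add: field_simps)
    finally show ?thesis .
  qed
  have "(\<Sum>n\<in>I. \<phi> (q n)) = (\<Sum>m=1..M. \<Sum>n\<in>{n\<in>I. q n = m}. \<phi> (q n))"
    using image by (intro sum.group[symmetric]) (auto simp: I_def)
  also have "\<dots> = (\<Sum>m=1..M. \<phi> m * of_nat (card {n\<in>I. q n = m}))"
    by (intro sum.cong refl) simp
  also have "\<dots> = (\<Sum>m=1..M. \<phi> m * of_real (real (card {n\<in>I. q n = m})))" by simp
  also have "\<dots> = (\<Sum>m=1..M. \<phi> m * of_real (x / (real m * real (Suc m)) + (saw (x / real (Suc m)) - saw (x / real m))))"
    by (intro sum.cong refl) (simp only: fiber)
  finally show ?thesis by (simp only: I_def q_def)
qed

section \<open>Sums and counts for a fixed divisor\<close>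

lemma cbrt_scale:
  assumes "0 < X" "1 \<le> d"
  shows "(X * real d powr (- 1 / 3)) ^ 3 = X ^ 3 / real d"
proof -
  have "(real d powr (- 1 / 3)) ^ 3 = real d powr (- 1)"
    using assms powr_realpow[of "real d powr (- 1 / 3)" 3] by (simp add: powr_powr)
  also have "\<dots> = 1 / real d" using assms by (simp add: powr_minus_divide)
  finally show ?thesis by (simp add: power_mult_distrib)
qed

text \<open>The value \<open>zeta(4/3)\<close>; the term \<open>d = 0\<close> is harmless because
  \<open>0 powr _ = 0\<close>. It arises from the weight \<open>1/d\<close> times the
  \<open>d^(-1/3)\<close> in the cube root of \<open>x/d\<close>.\<close>

definition zeta43 :: real where
  "zeta43 = (\<Sum>d. real d powr (- 4 / 3))"

lemma sum_powr_le_zeta43: "(\<Sum>d=1..L. real d powr (- 1 / 3) / real d) \<le> zeta43"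
proof -
  have "real d powr (- 1 / 3) / real d = real d powr (- 4 / 3)" if "1 \<le> d" for d :: nat
    using that powr_diff[of "real d" "- 1 / 3" 1] by simp
  then have "(\<Sum>d=1..L. real d powr (- 1 / 3) / real d) = (\<Sum>d=1..L. real d powr (- 4 / 3))"
    by (intro sum.cong) auto
  also have "\<dots> \<le> zeta43"
    unfolding zeta43_def by (intro sum_le_suminf) (auto simp: summable_real_powr_iff)
  finally show ?thesis .
qed

lemma zeta43_nonneg: "0 \<le> zeta43"
  using sum_powr_le_zeta43[of 0] by simp

text \<open>With \<open>Y^3 = X^3 / d\<close>, the arguments \<open>X^3/(d k)\<close> and
  \<open>X^3/(d k + 1)\<close> are the hyperbolas \<open>Y^3/(k + \<beta>)\<close> for
  \<open>\<beta> = 0\<close> and \<open>\<beta> = 1/d\<close>. The hypothesis on \<open>M\<close>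
  makes the second block term at most \<open>X/d \<le> Y\<close>.\<close>

lemma saw_sum_multiples:
  fixes X :: real and M J d :: nat
  assumes "0 < X" "1 \<le> d" "real M ^ 3 \<le> X ^ 5" "M < 2 ^ J"
  shows "\<bar>\<Sum>k=1..M div d. saw (X ^ 3 / (real (d * k) + 1)) - saw (X ^ 3 / real (d * k))\<bar>
    \<le> 1000 * real J * X * real d powr (- 1 / 3)"
proof -
  define Y where "Y = X * real d powr (- 1 / 3)"
  define K where "K = M div d"
  have Y: "0 < Y" "Y ^ 3 = X ^ 3 / real d"
    using assms cbrt_scale[of X d] by (auto simp: Y_def)
  have "K \<le> M" by (simp add: K_def)
  then have "K < 2 ^ J" using assms by linarith
  have sqrt_le: "sqrt (real K ^ 3 / Y ^ 3) \<le> Y"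
  proof -
    have "real K \<le> real M / real d" unfolding K_def by (rule of_nat_div_le_of_nat)
    then have "real K ^ 3 \<le> (real M / real d) ^ 3" by (intro power_mono) auto
    also have "\<dots> \<le> X ^ 5 / real d ^ 3"
      using assms by (simp add: power_divide divide_right_mono)
    finally have "real K ^ 3 / Y ^ 3 \<le> X ^ 5 / real d ^ 3 / (X ^ 3 / real d)"
      unfolding Y(2) using assms by (intro divide_right_mono) auto
    also have "\<dots> = (X / real d)\<^sup>2"
      using assms by (simp add: field_simps power_numeral_reduce)
    finally have "sqrt (real K ^ 3 / Y ^ 3) \<le> sqrt ((X / real d)\<^sup>2)"
      by (rule real_sqrt_le_mono)
    also have "\<dots> = X * real d powr (- 1)" using assms by (simp add: powr_minus_divide)
    also have "\<dots> \<le> Y"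
      unfolding Y_def using assms by (intro mult_left_mono powr_mono) auto
    finally show ?thesis .
  qed
  have bound: "\<bar>\<Sum>k=1..K. saw (Y ^ 3 / (real k + \<beta>) + 0)\<bar> \<le> real J * (250 * (2 * Y))"
    if "0 \<le> \<beta>" "\<beta> \<le> 1" for \<beta>
  proof -
    have "\<bar>\<Sum>k=1..K. saw (Y ^ 3 / (real k + \<beta>) + 0)\<bar> \<le> real J * (250 * (Y + sqrt (real K ^ 3 / Y ^ 3)))"
      by (rule saw_sum_prefix) (use Y that \<open>K < 2 ^ J\<close> in auto)
    also have "\<dots> \<le> real J * (250 * (2 * Y))"
      using sqrt_le by (intro mult_left_mono) auto
    finally show ?thesis .
  qed
  have "(\<Sum>k=1..K. saw (X ^ 3 / (real (d * k) + 1)) - saw (X ^ 3 / real (d * k)))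
      = (\<Sum>k=1..K. saw (Y ^ 3 / (real k + 1 / real d) + 0)) - (\<Sum>k=1..K. saw (Y ^ 3 / (real k + 0) + 0))"
    unfolding sum_subtractf[symmetric] Y(2) using assms
    by (intro sum.cong refl) (simp add: distrib_left)
  moreover have "\<bar>\<Sum>k=1..K. saw (Y ^ 3 / (real k + 1 / real d) + 0)\<bar> \<le> real J * (250 * (2 * Y))"
    using assms by (intro bound) auto
  moreover have "\<bar>\<Sum>k=1..K. saw (Y ^ 3 / (real k + 0) + 0)\<bar> \<le> real J * (250 * (2 * Y))"
    by (intro bound) auto
  ultimately have "\<bar>\<Sum>k=1..K. saw (X ^ 3 / (real (d * k) + 1)) - saw (X ^ 3 / real (d * k))\<bar>
      \<le> real J * (250 * (2 * Y)) + real J * (250 * (2 * Y))"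
    by linarith
  then show ?thesis by (simp add: K_def Y_def mult_ac)
qed

lemma div_minus_div_pred:
  fixes a :: int and d :: nat
  assumes "1 \<le> d"
  shows "a div int d - (a - 1) div int d = (if int d dvd a then 1 else 0)"
proof (cases "int d dvd a")
  case True
  then obtain k where k: "a = int d * k" by auto
  have "(a - 1) div int d = k - 1"
    using assms by (intro int_div_pos_eq[of _ _ _ "int d - 1"]) (auto simp: k algebra_simps)
  then show ?thesis using True assms by (simp add: k)
next
  case False
  define r where "r = a mod int d"
  have r: "0 \<le> r" "r < int d" "r \<noteq> 0" using assms False by (auto simp: r_def dvd_eq_mod_eq_0)
  have "(a - 1) div int d = a div int d"
    using r by (intro int_div_pos_eq[of _ _ _ "r - 1"]) (auto simp: r_def)
  then show ?thesis using False by simp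
qed

text \<open>For an integer \<open>a\<close>, \<open>a div d - (a - 1) div d\<close> detects the
  multiples of \<open>d\<close>. With \<open>a = [t]\<close> the nested floors collapse,
  \<open>[[t]/d] = [t/d]\<close>, which leaves two sawtooth values whose arguments differ by
  \<open>1/d\<close>.\<close>

lemma indicator_dvd_floor:
  assumes "0 \<le> t" "1 \<le> d"
  shows "(if d dvd nat \<lfloor>t\<rfloor> then 1 else 0) = 1 / real d + (saw (t / real d - 1 / real d) - saw (t / real d))"
proof -
  have "\<lfloor>t / real d\<rfloor> = \<lfloor>t\<rfloor> div int d"
    using floor_divide_real_eq_div[of "int d" t] by simp
  moreover have "\<lfloor>t / real d - 1 / real d\<rfloor> = (\<lfloor>t\<rfloor> - 1) div int d"
    using floor_divide_real_eq_div[of "int d" "t - 1"] by (simp add: diff_divide_distrib)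
  moreover have "int d dvd \<lfloor>t\<rfloor> \<longleftrightarrow> d dvd nat \<lfloor>t\<rfloor>"
    using assms by (metis int_dvd_int_iff int_nat_eq zero_le_floor)
  ultimately have "real_of_int (\<lfloor>t / real d\<rfloor> - \<lfloor>t / real d - 1 / real d\<rfloor>) = (if d dvd nat \<lfloor>t\<rfloor> then 1 else 0)"
    using div_minus_div_pred[OF assms(2), of "\<lfloor>t\<rfloor>"] by simp
  then show ?thesis by (simp add: saw_def frac_def)
qed

text \<open>The two sawtooth sums run along the same hyperbola \<open>Y^3/n\<close>, one with the
  constant shift \<open>- 1/d\<close>. Here \<open>n\<close> is not restricted to multiples of
  \<open>d\<close>, so the second block term grows with \<open>d\<close>; the hypothesis on
  \<open>N\<close> bounds it by \<open>sqrt (X * d)\<close>.\<close>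

lemma count_divisible_quotients:
  fixes X :: real and N0 N J d :: nat
  assumes "0 < X" "1 \<le> d" "real N ^ 3 \<le> X ^ 4" "N < 2 ^ J"
  shows "\<bar>real (card {n\<in>{N0<..N}. d dvd nat \<lfloor>X ^ 3 / real n\<rfloor>}) - real (card {N0<..N}) / real d\<bar>
    \<le> 1000 * real J * (X * real d powr (- 1 / 3) + sqrt (X * real d))"
proof -
  define Y where "Y = X * real d powr (- 1 / 3)"
  have Y: "0 < Y" "Y ^ 3 = X ^ 3 / real d"
    using assms cbrt_scale[of X d] by (auto simp: Y_def)
  have sqrt_le: "sqrt (real N ^ 3 / Y ^ 3) \<le> sqrt (X * real d)"
  proof (rule real_sqrt_le_mono)
    have "real N ^ 3 / Y ^ 3 \<le> X ^ 4 / (X ^ 3 / real d)"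
      unfolding Y(2) using assms by (intro divide_right_mono) auto
    also have "\<dots> = X * real d"
      using assms by (simp add: field_simps power_numeral_reduce)
    finally show "real N ^ 3 / Y ^ 3 \<le> X * real d" .
  qed
  define B where "B = real J * (500 * (Y + sqrt (X * real d)))"
  have bound: "\<bar>\<Sum>n\<in>{N0<..N}. saw (Y ^ 3 / (real n + 0) + c)\<bar> \<le> B" for c
  proof -
    have "\<bar>\<Sum>n\<in>{N0<..N}. saw (Y ^ 3 / (real n + 0) + c)\<bar> \<le> real J * (500 * (Y + sqrt (real N ^ 3 / Y ^ 3)))"
      by (rule saw_sum_interval) (use Y assms in auto)
    also have "\<dots> \<le> B"
      unfolding B_def using sqrt_le by (intro mult_left_mono) auto
    finally show ?thesis .
  qed
  have "real (card {n\<in>{N0<..N}. d dvd nat \<lfloor>X ^ 3 / real n\<rfloor>})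
      = (\<Sum>n\<in>{N0<..N}. if d dvd nat \<lfloor>X ^ 3 / real n\<rfloor> then 1 else 0)"
    by (simp add: sum.inter_filter[symmetric])
  also have "\<dots> = (\<Sum>n\<in>{N0<..N}. 1 / real d + (saw (Y ^ 3 / (real n + 0) + (- 1 / real d)) - saw (Y ^ 3 / (real n + 0) + 0)))"
  proof (rule sum.cong[OF refl])
    fix n
    have "X ^ 3 / real n / real d = X ^ 3 / real d / (real n + 0)" by (simp add: mult.commute)
    then show "(if d dvd nat \<lfloor>X ^ 3 / real n\<rfloor> then 1 else 0) =
        1 / real d + (saw (Y ^ 3 / (real n + 0) + (- 1 / real d)) - saw (Y ^ 3 / (real n + 0) + 0))"
      using indicator_dvd_floor[of "X ^ 3 / real n" d] assms unfolding Y(2) by (simp add: mult.commute)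
  qed
  also have "\<dots> = real (card {N0<..N}) / real d +
      ((\<Sum>n\<in>{N0<..N}. saw (Y ^ 3 / (real n + 0) + (- 1 / real d))) - (\<Sum>n\<in>{N0<..N}. saw (Y ^ 3 / (real n + 0) + 0)))"
    unfolding sum.distrib sum_subtractf by simp
  finally have "\<bar>real (card {n\<in>{N0<..N}. d dvd nat \<lfloor>X ^ 3 / real n\<rfloor>}) - real (card {N0<..N}) / real d\<bar>
      = \<bar>(\<Sum>n\<in>{N0<..N}. saw (Y ^ 3 / (real n + 0) + (- 1 / real d))) - (\<Sum>n\<in>{N0<..N}. saw (Y ^ 3 / (real n + 0) + 0))\<bar>"
    by simp
  also have "\<dots> \<le> B + B"
    by (intro order_trans[OF abs_triangle_ineq4 add_mono] bound)
  finally show ?thesis by (simp add: B_def Y_def algebra_simps)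
qed

text \<open>For \<open>n < n' \<le> N\<close> the numbers \<open>X^3/n\<close> and
  \<open>X^3/n'\<close> differ by at least \<open>X^3/(n n') \<ge> 1\<close>, so their integer parts
  are distinct. As \<open>n > X\<close> they do not exceed \<open>X^2\<close>, and at most
  \<open>X^2/d\<close> integers up to there are multiples of \<open>d\<close>.\<close>

lemma count_divisible_quotients_trivial:
  fixes X :: real and N0 N d :: nat
  assumes "0 < X" "1 \<le> d" "(real N)\<^sup>2 \<le> X ^ 3" "X < real N0 + 1"
  shows "real (card {n\<in>{N0<..N}. d dvd nat \<lfloor>X ^ 3 / real n\<rfloor>}) \<le> X\<^sup>2 / real d"
proof -
  define q where "q n = nat \<lfloor>X ^ 3 / real n\<rfloor>" for n
  define A where "A = {n\<in>{N0<..N}. d dvd q n}"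
  define L where "L = nat \<lfloor>X\<^sup>2\<rfloor>"
  have A: "1 \<le> n" "n \<le> N" "X < real n" if "n \<in> A" for n
    using that assms by (auto simp: A_def)
  have q_ge: "1 \<le> q n" if "n \<in> A" for n
  proof -
    have "real n * real n \<le> real N * real N" using A[OF that] by (intro mult_mono) auto
    moreover have "real n * 1 \<le> real n * real n" using A[OF that] by (intro mult_left_mono) auto
    ultimately have "real n \<le> X ^ 3" using assms by (simp add: power2_eq_square)
    then show ?thesis
      unfolding q_def using A[OF that] assms by (subst le_nat_floor_iff) auto
  qed
  have q_le: "q n \<le> L" if "n \<in> A" for n
  proof -
    have "X ^ 3 / real n \<le> X ^ 3 / X" using A[OF that] assms by (intro divide_left_mono) auto
    also have "\<dots> = X\<^sup>2" using assms by (simp add: power_numeral_reduce)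
    finally show ?thesis unfolding q_def L_def by (intro nat_mono floor_mono)
  qed
  have less: "q n' < q n" if "n \<in> A" "n' \<in> A" "n < n'" for n n'
  proof -
    have pos: "0 < real n" "0 < real n'" using A[OF that(1)] A[OF that(2)] by auto
    have "real n * real n' \<le> real N * real N"
      using A[OF that(1)] A[OF that(2)] by (intro mult_mono) auto
    also have "\<dots> \<le> X ^ 3 * (real n' - real n)"
    proof -
      have "X ^ 3 * 1 \<le> X ^ 3 * (real n' - real n)"
        using that(3) assms by (intro mult_left_mono) auto
      moreover have "real N * real N \<le> X ^ 3" using assms by (simp add: power2_eq_square)
      ultimately show ?thesis by linarith
    qed
    finally have "X ^ 3 / real n' + 1 \<le> X ^ 3 / real n"
      using pos by (simp add: field_simps)
    then have "\<lfloor>X ^ 3 / real n'\<rfloor> < \<lfloor>X ^ 3 / real n\<rfloor>" by linarith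
    moreover have "0 \<le> \<lfloor>X ^ 3 / real n'\<rfloor>" using assms pos by simp
    ultimately show ?thesis unfolding q_def by linarith
  qed
  have "inj_on q A"
  proof (rule inj_onI)
    fix a b assume "a \<in> A" "b \<in> A" "q a = q b"
    then show "a = b"
      using less[of a b] less[of b a] by (cases a b rule: linorder_cases) auto
  qed
  then have "card A = card (q ` A)" by (simp add: card_image)
  also have "\<dots> \<le> card {m\<in>{1..L}. d dvd m}"
    using q_ge q_le by (intro card_mono) (auto simp: A_def)
  also have "\<dots> = L div d"
    using sum_multiples[OF assms(2), of "\<lambda>_. 1::nat" L] by simp
  finally have "real (card A) \<le> real L / real d"
    using of_nat_div_le_of_nat[of L d, where 'a = real] by linarith
  also have "\<dots> \<le> X\<^sup>2 / real d"
    unfolding L_def by (intro divide_right_mono) auto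
  finally show ?thesis by (simp add: A_def q_def)
qed

section \<open>The asymptotic formula\<close>

context
  fixes g :: "nat \<Rightarrow> complex" and G :: real
  assumes g_bound: "\<And>n. 1 \<le> n \<Longrightarrow> norm (g n) \<le> G"
begin

lemma G_nonneg: "0 \<le> G"
  using g_bound[of 1] norm_ge_zero[of "g 1"] by linarith

lemma norm_weighted_sum_le:
  fixes w :: "nat \<Rightarrow> complex"
  shows "norm (\<Sum>d\<in>{1..L}. g d / of_nat d * w d) \<le> G * (\<Sum>d\<in>{1..L}. norm (w d) / real d)"
  unfolding sum_distrib_left
proof (rule sum_norm_le)
  fix d assume "d \<in> {1..L}"
  then have "norm (g d) * (norm (w d) / real d) \<le> G * (norm (w d) / real d)"
    by (intro mult_right_mono g_bound) auto
  then show "norm (g d / of_nat d * w d) \<le> G * (norm (w d) / real d)"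
    by (simp add: norm_mult norm_divide)
qed

lemma norm_quot_le:
  assumes "1 \<le> m"
  shows "norm (quot g m) \<le> G * (1 + ln (real m))"
proof -
  \<comment> \<open>A one-element index set, so that the general interchange of sums
    applies.\<close>
  have "quot g m = (\<Sum>n\<in>{m}. quot g n * 1)" by simp
  also have "\<dots> = (\<Sum>d=1..m. g d / of_nat d * (\<Sum>n\<in>{n\<in>{m}. d dvd n}. 1))"
    using assms by (intro sum_quot_swap) auto
  also have "norm \<dots> \<le> G * (\<Sum>d=1..m. norm (\<Sum>n\<in>{n\<in>{m}. d dvd n}. 1 :: complex) / real d)"
    by (rule norm_weighted_sum_le)
  also have "\<dots> \<le> G * (\<Sum>d=1..m. 1 / real d)"
  proof (intro mult_left_mono sum_mono divide_right_mono G_nonneg)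
    fix d
    have "{n\<in>{m}. d dvd n} = (if d dvd m then {m} else {})" by auto
    then show "norm (\<Sum>n\<in>{n\<in>{m}. d dvd n}. 1 :: complex) \<le> 1" by simp
  qed auto
  also have "\<dots> \<le> G * (1 + ln (real m))"
    by (intro mult_left_mono sum_inverse_le_ln assms G_nonneg)
  finally show ?thesis .
qed

section \<open>The mean value of \<open>f(m)/m\<close>\<close>

lemma dens_partial_sum:
  assumes "1 \<le> m"
  shows "norm (dens g - (\<Sum>d=1..m. g d / of_nat d ^ 2)) \<le> G / real m"
proof -
  define b where "b d = g d / of_nat d ^ 2" for d
  have b: "norm (b d) \<le> G * (1 / (real d)\<^sup>2)" if "1 \<le> d" for d
    using g_bound[OF that] by (simp add: b_def norm_divide norm_power divide_right_mono)
  have "summable (\<lambda>d. G * (1 / (real (Suc d))\<^sup>2))"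
    using summable_Suc_iff[of "\<lambda>n. inverse ((real n)\<^sup>2)"] inverse_power_summable[of 2]
    by (intro summable_mult) (simp add: inverse_eq_divide)
  then have "summable (\<lambda>d. b (Suc d))"
    by (rule summable_comparison_test'[where N = 0]) (rule b, simp)
  then have "(\<lambda>L. \<Sum>d<L. b (Suc d)) \<longlonglongrightarrow> dens g"
    unfolding dens_def b_def by (rule summable_LIMSEQ)
  then have "(\<lambda>L. (\<Sum>d=1..L. b d) - (\<Sum>d=1..m. b d)) \<longlonglongrightarrow> dens g - (\<Sum>d=1..m. b d)"
    by (intro tendsto_diff tendsto_const) (simp add: sum.atLeast1_atMost_eq)
  moreover have "norm ((\<Sum>d=1..L. b d) - (\<Sum>d=1..m. b d)) \<le> G / real m" if "m \<le> L" for L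
  proof -
    have "{1..L} = {1..m} \<union> {Suc m..L}" using that by auto
    then have "(\<Sum>d=1..L. b d) = (\<Sum>d=1..m. b d) + (\<Sum>d=Suc m..L. b d)"
      by (simp only:) (subst sum.union_disjoint; auto)
    then have "norm ((\<Sum>d=1..L. b d) - (\<Sum>d=1..m. b d)) = norm (\<Sum>d=Suc m..L. b d)" by simp
    also have "\<dots> \<le> (\<Sum>d=Suc m..L. G * (1 / (real d)\<^sup>2))"
      by (intro sum_norm_le b) auto
    also have "\<dots> \<le> G * (1 / real m - 1 / real L)"
      unfolding sum_distrib_left[symmetric] using assms that
      by (intro mult_left_mono sum_inverse_square_le G_nonneg) auto
    also have "\<dots> \<le> G / real m"
      using G_nonneg by (simp add: right_diff_distrib)
    finally show ?thesis .
  qed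
  ultimately show ?thesis
    unfolding b_def by (intro LIMSEQ_le_const2[OF tendsto_norm]) (auto intro: exI[of _ m])
qed

lemma norm_dens_le: "norm (dens g) \<le> 2 * G"
  using dens_partial_sum[of 1] g_bound[of 1] norm_triangle_sub[of "dens g" "g 1"] by simp

text \<open>Replacing \<open>m div d\<close> by \<open>m / d\<close> costs at most \<open>1\<close>
  for each \<open>d\<close>, in total \<open>G\<close> times a harmonic sum; completing the series
  of \<open>dens g\<close> costs at most \<open>G\<close>. Relaxing the logarithm to
  \<open>sqrt m\<close> still yields a tail of order \<open>M^(-3/2)\<close>, and
  \<open>x M^(-3/2)\<close> is \<open>O(x^(1/3))\<close> once
  \<open>M \<ge> x^(4/9)\<close>.\<close>

lemma quot_partial_sum:
  assumes "1 \<le> m"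
  shows "norm ((\<Sum>j=1..m. quot g j) - dens g * of_nat m) \<le> 4 * G * sqrt (real m)"
proof -
  have "(\<Sum>j=1..m. quot g j) = (\<Sum>j=1..m. quot g j * 1)" by simp
  also have "\<dots> = (\<Sum>d=1..m. g d / of_nat d * (\<Sum>j\<in>{j\<in>{1..m}. d dvd j}. 1))"
    by (intro sum_quot_swap) auto
  also have "\<dots> = (\<Sum>d=1..m. g d / of_nat d * of_nat (m div d))"
    by (intro sum.cong refl, subst sum_multiples) auto
  finally have "(\<Sum>j=1..m. quot g j) - of_nat m * (\<Sum>d=1..m. g d / of_nat d ^ 2)
      = (\<Sum>d=1..m. g d / of_nat d * (of_nat (m div d) - of_nat m / of_nat d))"
    by (simp add: sum_distrib_left right_diff_distrib sum_subtractf power2_eq_square mult_ac)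
  also have "norm \<dots> \<le> G * (\<Sum>d=1..m. norm (of_nat (m div d) - of_nat m / of_nat d :: complex) / real d)"
    by (rule norm_weighted_sum_le)
  also have "\<dots> \<le> G * (\<Sum>d=1..m. 1 / real d)"
  proof (intro mult_left_mono sum_mono divide_right_mono G_nonneg)
    fix d assume "d \<in> {1..m}"
    have "norm (of_nat (m div d) - of_nat m / of_nat d :: complex) = \<bar>real (m div d) - real m / real d\<bar>"
      by (metis (no_types) norm_of_real of_real_diff of_real_divide of_real_of_nat_eq)
    also have "\<dots> \<le> 1"
    proof -
      have "real (m div d) = of_int \<lfloor>real m / real d\<rfloor>" by (simp add: floor_divide_of_nat_eq)
      then show ?thesis by linarith
    qed
    finally show "norm (of_nat (m div d) - of_nat m / of_nat d :: complex) \<le> 1" .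
  qed auto
  also have "\<dots> \<le> G * (2 * sqrt (real m))"
    using sum_inverse_le_ln[OF assms] one_plus_ln_le_sqrt[OF assms]
    by (intro mult_left_mono G_nonneg) auto
  finally have 1: "norm ((\<Sum>j=1..m. quot g j) - of_nat m * (\<Sum>d=1..m. g d / of_nat d ^ 2)) \<le> G * (2 * sqrt (real m))" .
  have "norm (of_nat m * (dens g - (\<Sum>d=1..m. g d / of_nat d ^ 2))) \<le> real m * (G / real m)"
    unfolding norm_mult norm_of_nat by (intro mult_left_mono dens_partial_sum assms) auto
  also have "\<dots> \<le> G * (2 * sqrt (real m))"
  proof -
    have "1 \<le> sqrt (real m)" using assms by simp
    then have "1 \<le> 2 * sqrt (real m)" by linarith
    from mult_left_mono[OF this G_nonneg] have "G * 1 \<le> G * (2 * sqrt (real m))" .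
    then show ?thesis using assms by simp
  qed
  finally have 2: "norm (of_nat m * (dens g - (\<Sum>d=1..m. g d / of_nat d ^ 2))) \<le> G * (2 * sqrt (real m))" .
  have "(\<Sum>j=1..m. quot g j) - dens g * of_nat m =
      ((\<Sum>j=1..m. quot g j) - of_nat m * (\<Sum>d=1..m. g d / of_nat d ^ 2))
      - of_nat m * (dens g - (\<Sum>d=1..m. g d / of_nat d ^ 2))"
    by (simp add: algebra_simps)
  also have "norm \<dots> \<le> G * (2 * sqrt (real m)) + G * (2 * sqrt (real m))"
    using 1 2 by (intro order_trans[OF norm_triangle_ineq4 add_mono])
  finally show ?thesis by (simp add: algebra_simps)
qed

section \<open>The series and its tail\<close>

lemma main_series_LIMSEQ:
  "(\<lambda>L. \<Sum>m=1..L. quot g m / (of_nat m * of_nat (Suc m))) \<longlonglongrightarrow> main_series g"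
proof -
  have "summable (\<lambda>n. real n powr (- 3 / 2))" by (subst summable_real_powr_iff) simp
  then have "summable (\<lambda>n. 2 * G * real (Suc n) powr (- 3 / 2))"
    by (intro summable_mult) (subst summable_Suc_iff)
  then have "summable (\<lambda>m. quot g (Suc m) / (of_nat (Suc m) * of_nat (Suc (Suc m))))"
  proof (rule summable_comparison_test'[where N = 0])
    fix n :: nat
    define m where "m = Suc n"
    have m: "1 \<le> m" by (simp add: m_def)
    have "norm (quot g m / (of_nat m * of_nat (Suc m))) = norm (quot g m) / (real m * real (Suc m))"
      by (simp add: norm_divide norm_mult del: of_nat_Suc)
    also have "\<dots> \<le> (2 * G * sqrt (real m)) / (real m * real m)"
    proof (rule frac_le)
      have "G * (1 + ln (real m)) \<le> G * (2 * sqrt (real m))"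
        using one_plus_ln_le_sqrt[OF m] by (intro mult_left_mono G_nonneg)
      then show "norm (quot g m) \<le> 2 * G * sqrt (real m)"
        using norm_quot_le[OF m] by simp
    qed (use m G_nonneg in auto)
    also have "\<dots> = 2 * G * (real m powr (1/2) / real m powr 2)"
      using m by (simp add: powr_half_sqrt power2_eq_square)
    also have "real m powr (1/2) / real m powr 2 = real m powr (- 3 / 2)"
      using powr_diff[of "real m" "1/2" 2] by simp
    finally show "norm (quot g (Suc n) / (of_nat (Suc n) * of_nat (Suc (Suc n)))) \<le> 2 * G * real (Suc n) powr (- 3 / 2)"
      by (simp only: m_def)
  qed
  from summable_LIMSEQ[OF this] show ?thesis
    unfolding main_series_def One_nat_def sum.atLeast1_atMost_eq .
qed

text \<open>Summation by parts, using \<open>sqrt m \<le> m / sqrt M\<close> for \<open>m \<ge> M\<close> so that the remaining sum telescopes.\<close>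

lemma main_series_tail_partial:
  assumes "1 \<le> M" "M \<le> L"
  shows "norm ((\<Sum>m=Suc M..L. quot g m / (of_nat m * of_nat (Suc m)))
      - dens g * of_real (1 / real (Suc M) - 1 / real (Suc L))) \<le> 16 * G / (real M * sqrt (real M))"
proof -
  define R where "R m = (\<Sum>j=1..m. quot g j) - dens g * of_nat m" for m
  define w where "w m = 1 / (real m * real (Suc m))" for m
  define T where "T L = (\<Sum>m=Suc M..L. quot g m / (of_nat m * of_nat (Suc m)))
      - dens g * of_real (1 / real (Suc M) - 1 / real (Suc L))" for L
  define B where "B = 4 * G / sqrt (real M)"
  have sqrtM: "1 \<le> sqrt (real M)" using assms by simp
  have B: "0 \<le> B" using G_nonneg by (simp add: B_def)
  have w_pos: "0 \<le> w m" for m by (simp add: w_def)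
  have R_le: "norm (R m) \<le> B * real m" if "M \<le> m" for m
  proof -
    have "sqrt (real m) * sqrt (real M) \<le> sqrt (real m) * sqrt (real m)"
      using that by (intro mult_left_mono) auto
    then have "sqrt (real m) \<le> real m / sqrt (real M)"
      using sqrtM by (simp add: field_simps)
    then have "4 * G * sqrt (real m) \<le> 4 * G * (real m / sqrt (real M))"
      using G_nonneg by (intro mult_left_mono) auto
    moreover have "norm (R m) \<le> 4 * G * sqrt (real m)"
      unfolding R_def using that assms by (intro quot_partial_sum) auto
    ultimately show ?thesis by (simp add: B_def)
  qed
  \<comment> \<open>Summation by parts as an induction on \<open>L\<close>: the boundary term pairs
    \<open>R L\<close> with the weight one index ahead, and \<open>T M = 0\<close> starts
    it.\<close>
  have "norm (T L - R L * of_real (w (Suc L)))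
      \<le> norm (R M) * w (Suc M) + 2 * B * (1 / real (M + 2) - 1 / real (L + 2))"
    using assms(2)
  proof (induction L rule: dec_induct)
    case base
    then show ?case using w_pos[of "Suc M"] by (simp add: T_def norm_mult)
  next
    case (step L)
    have wS: "w (Suc L) = 1 / real (Suc L) - 1 / real (Suc (Suc L))"
      by (simp add: w_def field_simps)
    have TS: "T (Suc L) = T L + (quot g (Suc L) - dens g) * of_real (w (Suc L))"
    proof -
      have "of_real (1 / real (Suc M) - 1 / real (Suc (Suc L))) =
          of_real (1 / real (Suc M) - 1 / real (Suc L)) + (of_real (w (Suc L)) :: complex)"
        unfolding of_real_add[symmetric] by (simp only: wS) simp
      moreover have "quot g (Suc L) / (of_nat (Suc L) * of_nat (Suc (Suc L))) = quot g (Suc L) * of_real (w (Suc L))"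
        by (simp add: w_def del: of_nat_Suc)
      ultimately show ?thesis
        using step.hyps by (simp add: T_def sum.cl_ivl_Suc algebra_simps del: of_nat_Suc)
    qed
    have RS: "R (Suc L) = R L + (quot g (Suc L) - dens g)"
      by (simp add: R_def algebra_simps)
    have "T (Suc L) - R (Suc L) * of_real (w (Suc (Suc L)))
        = (T L - R L * of_real (w (Suc L))) + R (Suc L) * of_real (w (Suc L) - w (Suc (Suc L)))"
      unfolding TS RS of_real_diff by (simp add: algebra_simps)
    moreover have "norm (R (Suc L) * of_real (w (Suc L) - w (Suc (Suc L))))
        \<le> 2 * B * (1 / real (L + 2) - 1 / real (Suc L + 2))"
    proof -
      \<comment> \<open>The factor \<open>Suc L\<close> of this denominator cancels the growth of
        the bound for \<open>R (Suc L)\<close>; what is left telescopes.\<close>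
      have w_eq: "w (Suc L) - w (Suc (Suc L)) = 2 / (real (Suc L) * real (L + 2) * real (L + 3))"
        by (simp add: w_def divide_simps del: of_nat_Suc of_nat_add) (simp add: algebra_simps)
      have "norm (R (Suc L) * of_real (w (Suc L) - w (Suc (Suc L))))
          \<le> (B * real (Suc L)) * (2 / (real (Suc L) * real (L + 2) * real (L + 3)))"
        unfolding norm_mult w_eq norm_of_real using step.hyps B
        by (intro mult_mono R_le) auto
      also have "\<dots> = 2 * B * (1 / (real (L + 2) * real (L + 3)))" by simp
      also have "1 / (real (L + 2) * real (L + 3)) = 1 / real (L + 2) - 1 / real (Suc L + 2)"
        by (simp add: field_simps)
      finally show ?thesis .
    qed
    ultimately have "norm (T (Suc L) - R (Suc L) * of_real (w (Suc (Suc L))))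
      \<le> norm (T L - R L * of_real (w (Suc L))) + 2 * B * (1 / real (L + 2) - 1 / real (Suc L + 2))"
      by (simp only:) (rule norm_triangle_le, rule add_left_mono)
    also have "\<dots> \<le> norm (R M) * w (Suc M) + 2 * B * (1 / real (M + 2) - 1 / real (L + 2))
      + 2 * B * (1 / real (L + 2) - 1 / real (Suc L + 2))"
      using step.IH by (rule add_right_mono)
    finally show ?case by (simp only: right_diff_distrib)
  qed
  moreover have "norm (R m) * w (Suc m) \<le> B * (1 / real M)" if "M \<le> m" for m
  proof -
    have "norm (R m) * w (Suc m) \<le> (B * real m) * w (Suc m)"
      by (intro mult_right_mono R_le that w_pos)
    also have "\<dots> \<le> B * (1 / real M)"
    proof -
      have "real M * real m \<le> real (Suc m) * real (Suc (Suc m))"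
        using that by (intro mult_mono) auto
      then have "w (Suc m) \<le> 1 / (real M * real m)"
        unfolding w_def using assms that by (intro divide_left_mono mult_pos_pos) auto
      then have "real m * w (Suc m) \<le> real m * (1 / (real M * real m))"
        by (rule mult_left_mono) simp
      also have "\<dots> = 1 / real M" using assms that by simp
      finally have "real m * w (Suc m) \<le> 1 / real M" .
      from mult_left_mono[OF this B] show ?thesis by (simp only: mult.assoc)
    qed
    finally show ?thesis .
  qed
  from this[of M] this[of L]
  have "norm (R M) * w (Suc M) \<le> B * (1 / real M)" "norm (R L) * w (Suc L) \<le> B * (1 / real M)"
    using assms by auto
  moreover have "2 * B * (1 / real (M + 2) - 1 / real (L + 2)) \<le> 2 * B * (1 / real M)"
  proof (rule mult_left_mono)
    have "1 / real (M + 2) \<le> 1 / real M"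
      using assms by (intro divide_left_mono) auto
    moreover have "0 \<le> 1 / real (L + 2)" by simp
    ultimately show "1 / real (M + 2) - 1 / real (L + 2) \<le> 1 / real M" by linarith
  qed (use B in simp)
  moreover have "norm (T L) \<le> norm (T L - R L * of_real (w (Suc L))) + norm (R L) * w (Suc L)"
    using norm_triangle_sub[of "T L" "R L * of_real (w (Suc L))"] w_pos[of "Suc L"]
    by (simp add: norm_mult)
  \<comment> \<open>One share each from the boundary terms at \<open>M\<close> and at
    \<open>L\<close>, two from the telescoped sum.\<close>
  ultimately have "norm (T L) \<le> 4 * (B * (1 / real M))" by linarith
  then show ?thesis by (simp add: T_def B_def mult_ac)
qed

text \<open>The term \<open>dens g / (M + 1)\<close> is kept explicit because, multiplied by
  \<open>x\<close>, it cancels the main contribution of the \<open>n\<close> up to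
  \<open>x/(M + 1)\<close>.\<close>

lemma main_series_tail:
  assumes "1 \<le> M"
  shows "norm (main_series g - (\<Sum>m=1..M. quot g m / (of_nat m * of_nat (Suc m))) - dens g / of_nat (Suc M))
    \<le> 16 * G / (real M * sqrt (real M))"
proof -
  define t where "t m = quot g m / (of_nat m * of_nat (Suc m))" for m
  have "(\<lambda>L. (\<Sum>m=1..L. t m) - (\<Sum>m=1..M. t m) - dens g * of_real (1 / real (Suc M) - 1 / real (Suc L)))
      \<longlonglongrightarrow> main_series g - (\<Sum>m=1..M. t m) - dens g * of_real (1 / real (Suc M) - 0)"
    unfolding t_def
    by (intro tendsto_intros main_series_LIMSEQ LIMSEQ_inverse_real_of_nat[unfolded inverse_eq_divide])
  moreover have "norm ((\<Sum>m=1..L. t m) - (\<Sum>m=1..M. t m) - dens g * of_real (1 / real (Suc M) - 1 / real (Suc L)))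
      \<le> 16 * G / (real M * sqrt (real M))" if "M \<le> L" for L
  proof -
    have "{1..L} = {1..M} \<union> {Suc M..L}" using that by auto
    then have "(\<Sum>m=1..L. t m) = (\<Sum>m=1..M. t m) + (\<Sum>m=Suc M..L. t m)"
      by (simp only:) (subst sum.union_disjoint; auto)
    then show ?thesis
      using main_series_tail_partial[OF assms that] by (simp add: t_def)
  qed
  ultimately have "norm (main_series g - (\<Sum>m=1..M. t m) - dens g * of_real (1 / real (Suc M) - 0))
      \<le> 16 * G / (real M * sqrt (real M))"
    by (intro LIMSEQ_le_const2[OF tendsto_norm]) (auto intro: exI[of _ M])
  then show ?thesis by (simp add: t_def)
qed

section \<open>Error terms of the separate ranges of \<open>n\<close>\<close>

text \<open>The multiples of \<open>d\<close> contribute a bound with a factor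
  \<open>d^(-1/3)\<close>; together with the weight \<open>1/d\<close> this sums to a constant, so
  \<open>J\<close> remains the only logarithmic factor.\<close>

lemma quot_saw_sum_bound:
  assumes "0 < X" "real M ^ 3 \<le> X ^ 5" "M < 2 ^ J"
  shows "norm (\<Sum>m=1..M. quot g m * of_real (saw (X ^ 3 / real (Suc m)) - saw (X ^ 3 / real m)))
    \<le> 1000 * G * real J * X * zeta43"
proof -
  define s where "s m = saw (X ^ 3 / (real m + 1)) - saw (X ^ 3 / real m)" for m
  have "(\<Sum>m=1..M. quot g m * of_real (saw (X ^ 3 / real (Suc m)) - saw (X ^ 3 / real m)))
      = (\<Sum>m=1..M. quot g m * of_real (s m))"
    by (simp add: s_def add.commute)
  also have "\<dots> = (\<Sum>d=1..M. g d / of_nat d * (\<Sum>m\<in>{m\<in>{1..M}. d dvd m}. of_real (s m)))"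
    by (intro sum_quot_swap) auto
  also have "norm \<dots> \<le> G * (\<Sum>d=1..M. norm (\<Sum>m\<in>{m\<in>{1..M}. d dvd m}. of_real (s m) :: complex) / real d)"
    by (rule norm_weighted_sum_le)
  also have "\<dots> \<le> G * (\<Sum>d=1..M. 1000 * real J * X * (real d powr (- 1 / 3) / real d))"
  proof (intro mult_left_mono sum_mono G_nonneg)
    fix d assume d: "d \<in> {1..M}"
    then have "(\<Sum>m\<in>{m\<in>{1..M}. d dvd m}. of_real (s m) :: complex) = of_real (\<Sum>k=1..M div d. s (d * k))"
      by (subst sum_multiples) auto
    then have "norm (\<Sum>m\<in>{m\<in>{1..M}. d dvd m}. of_real (s m) :: complex)
        = \<bar>\<Sum>k=1..M div d. saw (X ^ 3 / (real (d * k) + 1)) - saw (X ^ 3 / real (d * k))\<bar>"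
      by (simp only: norm_of_real s_def)
    also have "\<dots> \<le> 1000 * real J * X * real d powr (- 1 / 3)"
      using assms d by (intro saw_sum_multiples) auto
    finally show "norm (\<Sum>m\<in>{m\<in>{1..M}. d dvd m}. of_real (s m) :: complex) / real d
        \<le> 1000 * real J * X * (real d powr (- 1 / 3) / real d)"
      by (simp add: divide_right_mono)
  qed
  also have "\<dots> \<le> G * (1000 * real J * X * zeta43)"
    unfolding sum_distrib_left[symmetric] using assms
    by (intro mult_left_mono sum_powr_le_zeta43 G_nonneg) auto
  finally show ?thesis by (simp add: mult_ac)
qed

text \<open>All three error sums over \<open>d\<close>, weighted by \<open>1/d\<close>, balance at
  \<open>X\<close>: the cube root part converges, \<open>sqrt (X d) / d\<close> over
  \<open>d \<le> N0\<close> gives \<open>2 sqrt (X N0) \<le> 2 X\<close>, and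
  \<open>X^2 / d^2\<close> over \<open>d > N0\<close> gives
  \<open>X^2 / N0 \<le> 2 X\<close>.\<close>

lemma quot_middle_sum_bound:
  fixes X :: real and N0 N J :: nat
  assumes "0 < X" "1 \<le> N0" "real N0 \<le> X" "X < real N0 + 1"
    and "real N ^ 3 \<le> X ^ 4" "(real N)\<^sup>2 \<le> X ^ 3" "N < 2 ^ J"
  shows "norm ((\<Sum>n\<in>{N0<..N}. quot g (nat \<lfloor>X ^ 3 / real n\<rfloor>))
      - of_nat (card {N0<..N}) * (\<Sum>d=1..N0. g d / of_nat d ^ 2))
    \<le> G * (1000 * real J * (X * zeta43 + 2 * X) + 2 * X)"
proof -
  define q where "q n = nat \<lfloor>X ^ 3 / real n\<rfloor>" for n
  define I where "I = {N0<..N}"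
  define L where "L = nat \<lfloor>X ^ 3\<rfloor>"
  define A where "A d = {n\<in>I. d dvd q n}" for d
  have "1 \<le> X" using assms by linarith
  then have "X ^ 1 \<le> X ^ 3" by (intro power_increasing) auto
  then have N0L: "N0 \<le> L"
    unfolding L_def using assms by (subst le_nat_floor_iff) auto
  have q: "1 \<le> q n \<and> q n \<le> L" if "n \<in> I" for n
  proof
    have n: "1 \<le> real n" "real n \<le> real N" using that assms by (auto simp: I_def)
    have "real n * 1 \<le> real n * real n" using n by (intro mult_left_mono) auto
    also have "\<dots> \<le> real N * real N" using n by (intro mult_mono) auto
    also have "\<dots> \<le> X ^ 3" using assms by (simp add: power2_eq_square)
    finally show "1 \<le> q n"
      unfolding q_def using n assms by (subst le_nat_floor_iff) auto
    have "X ^ 3 / real n \<le> X ^ 3 / 1" using n assms by (intro divide_left_mono) auto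
    then show "q n \<le> L" unfolding q_def L_def by (intro nat_mono floor_mono) simp
  qed
  \<comment> \<open>The expected count \<open>card I / d\<close> is subtracted only for
    \<open>d \<le> N0\<close>, so the main term carries the truncated series of the mean
    value.\<close>
  define w :: "nat \<Rightarrow> complex" where
    "w d = of_nat (card (A d)) - (if d \<le> N0 then of_nat (card I) / of_nat d else 0)" for d
  define B where
    "B d = (if d \<le> N0 then 1000 * real J * (X * real d powr (- 1 / 3) + sqrt (X * real d)) else X\<^sup>2 / real d)" for d
  have w_le: "norm (w d) \<le> B d" if "1 \<le> d" for d
  proof (cases "d \<le> N0")
    case True
    then have "w d = of_real (real (card (A d)) - real (card I) / real d)" by (simp add: w_def)
    then have "norm (w d) = \<bar>real (card (A d)) - real (card I) / real d\<bar>" by (simp only: norm_of_real)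
    also have "\<dots> \<le> 1000 * real J * (X * real d powr (- 1 / 3) + sqrt (X * real d))"
      unfolding A_def I_def q_def using assms that by (intro count_divisible_quotients) auto
    finally show ?thesis using True by (simp add: B_def)
  next
    case False
    then have "norm (w d) = real (card (A d))" by (simp add: w_def)
    also have "\<dots> \<le> X\<^sup>2 / real d"
      unfolding A_def I_def q_def using assms that by (intro count_divisible_quotients_trivial) auto
    finally show ?thesis using False by (simp add: B_def)
  qed
  have split: "{1..L} = {1..N0} \<union> {Suc N0..L}" using N0L by auto
  have "(\<Sum>n\<in>I. quot g (q n)) = (\<Sum>n\<in>I. quot g (q n) * 1)" by simp
  also have "\<dots> = (\<Sum>d=1..L. g d / of_nat d * (\<Sum>n\<in>{n\<in>I. d dvd q n}. 1))"
    using q by (intro sum_quot_swap) (auto simp: I_def)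
  also have "\<dots> = (\<Sum>d=1..L. g d / of_nat d * w d)
      + (\<Sum>d=1..L. g d / of_nat d * (if d \<le> N0 then of_nat (card I) / of_nat d else 0))"
    unfolding sum.distrib[symmetric] distrib_left[symmetric] by (simp add: w_def A_def)
  also have "(\<Sum>d=1..L. g d / of_nat d * (if d \<le> N0 then of_nat (card I) / of_nat d else 0))
      = (\<Sum>d=1..N0. g d / of_nat d * (of_nat (card I) / of_nat d))"
    using N0L by (intro sum.mono_neutral_cong_right) auto
  also have "\<dots> = of_nat (card I) * (\<Sum>d=1..N0. g d / of_nat d ^ 2)"
    by (simp add: sum_distrib_left power2_eq_square mult_ac)
  finally have "norm ((\<Sum>n\<in>I. quot g (q n)) - of_nat (card I) * (\<Sum>d=1..N0. g d / of_nat d ^ 2))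
      = norm (\<Sum>d=1..L. g d / of_nat d * w d)" by simp
  also have "\<dots> \<le> G * (\<Sum>d=1..L. norm (w d) / real d)"
    by (rule norm_weighted_sum_le)
  also have "\<dots> \<le> G * (\<Sum>d=1..L. B d / real d)"
    by (intro mult_left_mono sum_mono divide_right_mono w_le G_nonneg) auto
  also have "(\<Sum>d=1..L. B d / real d) = (\<Sum>d=1..N0. B d / real d) + (\<Sum>d=Suc N0..L. B d / real d)"
    unfolding split by (intro sum.union_disjoint) auto
  also have "(\<Sum>d=1..N0. B d / real d)
      = 1000 * real J * (X * (\<Sum>d=1..N0. real d powr (- 1 / 3) / real d) + sqrt X * (\<Sum>d=1..N0. 1 / sqrt (real d)))"
    unfolding sum_distrib_left sum.distrib[symmetric]
  proof (rule sum.cong[OF refl])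
    fix d assume "d \<in> {1..N0}"
    moreover have "sqrt (X * real d) / real d = sqrt X * (1 / sqrt (real d))"
      by (simp add: real_sqrt_mult sqrt_divide_self_eq inverse_eq_divide flip: times_divide_eq_right)
    moreover have "B d / real d = 1000 * real J * (X * (real d powr (- 1 / 3) / real d) + sqrt (X * real d) / real d)"
      if "d \<le> N0" using that by (simp add: B_def add_divide_distrib distrib_left)
    ultimately show "B d / real d = 1000 * real J * (X * (real d powr (- 1 / 3) / real d) + sqrt X * (1 / sqrt (real d)))"
      by simp
  qed
  also have "\<dots> \<le> 1000 * real J * (X * zeta43 + 2 * X)"
  proof (intro mult_left_mono add_mono sum_powr_le_zeta43)
    have "sqrt X * (\<Sum>d=1..N0. 1 / sqrt (real d)) \<le> sqrt X * (2 * sqrt X)"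
    proof (rule mult_left_mono)
      have "(\<Sum>d=1..N0. 1 / sqrt (real d)) \<le> 2 * sqrt (real N0)" by (rule sum_inverse_sqrt_le)
      also have "\<dots> \<le> 2 * sqrt X" using assms by simp
      finally show "(\<Sum>d=1..N0. 1 / sqrt (real d)) \<le> 2 * sqrt X" .
    qed (use assms in simp)
    also have "\<dots> = 2 * X" using assms by simp
    finally show "sqrt X * (\<Sum>d=1..N0. 1 / sqrt (real d)) \<le> 2 * X" .
  qed (use assms in auto)
  also have "(\<Sum>d=Suc N0..L. B d / real d) = X\<^sup>2 * (\<Sum>d=Suc N0..L. 1 / (real d)\<^sup>2)"
    unfolding sum_distrib_left by (intro sum.cong refl) (auto simp: B_def power2_eq_square)
  also have "\<dots> \<le> X\<^sup>2 * (1 / real N0)"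
  proof (rule mult_left_mono)
    have "(\<Sum>d=Suc N0..L. 1 / (real d)\<^sup>2) \<le> 1 / real N0 - 1 / real L"
      using assms N0L by (intro sum_inverse_square_le) auto
    then show "(\<Sum>d=Suc N0..L. 1 / (real d)\<^sup>2) \<le> 1 / real N0"
      by (rule order_trans) simp
  qed simp
  also have "\<dots> \<le> 2 * X"
  proof -
    have "X \<le> 2 * real N0" using assms by linarith
    then have "X * X \<le> X * (2 * real N0)" using assms by (intro mult_left_mono) auto
    then show ?thesis using assms by (simp add: power2_eq_square field_simps)
  qed
  finally show ?thesis
    unfolding I_def q_def using G_nonneg by (simp add: mult_left_mono)
qed

lemma quot_small_sum_bound:
  assumes "1 \<le> x" "real K \<le> x"
  shows "norm (\<Sum>n=1..K. quot g (nat \<lfloor>x / real n\<rfloor>)) \<le> real K * (G * (1 + ln x))"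
proof -
  have "norm (quot g (nat \<lfloor>x / real n\<rfloor>)) \<le> G * (1 + ln x)" if n: "n \<in> {1..K}" for n
  proof -
    define m where "m = nat \<lfloor>x / real n\<rfloor>"
    have "1 \<le> m"
      unfolding m_def using assms n by (subst le_nat_floor_iff) auto
    moreover have "real m \<le> x"
    proof -
      have "real m \<le> x / real n" unfolding m_def using assms by simp
      also have "\<dots> \<le> x / 1" using assms n by (intro divide_left_mono) auto
      finally show ?thesis by simp
    qed
    ultimately have "G * (1 + ln (real m)) \<le> G * (1 + ln x)"
      by (intro mult_left_mono G_nonneg) auto
    then show ?thesis using norm_quot_le[OF \<open>1 \<le> m\<close>] by (simp add: m_def)
  qed
  from sum_norm_le[of "{1..K}", OF this] show ?thesis by simp
qed

section \<open>Assembly of the ranges\<close>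

lemma quot_sum_estimate:
  assumes "512 \<le> x"
  shows "norm ((\<Sum>n=1..nat \<lfloor>x\<rfloor>. quot g (nat \<lfloor>x / real n\<rfloor>)) - of_real x * main_series g)
    \<le> G * (6000 * zeta43 + 6100) * (x powr (1/3) * ln x)"
proof -
  \<comment> \<open>With \<open>x = Z ^ 9\<close> every threshold of the argument is an integral power of \<open>Z\<close>.\<close>
  define Z where "Z = x powr (1/9)"
  define X where "X = Z ^ 3"
  define M where "M = nat \<lfloor>Z ^ 5\<rfloor>"
  \<comment> \<open>Not \<open>[Z^4]\<close>: with this \<open>N\<close> the range
    \<open>n > N\<close> consists of complete sets of constant quotient
    \<open>m \<le> M\<close>.\<close>
  define N where "N = nat \<lfloor>x / real (Suc M)\<rfloor>"
  define N0 where "N0 = nat \<lfloor>X\<rfloor>"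
  define J where "J = Suc (nat \<lfloor>log 2 x\<rfloor>)"
  define q where "q n = nat \<lfloor>x / real n\<rfloor>" for n
  define D where "D = dens g"
  have x: "0 < x" "1 \<le> x" using assms by auto
  have x_eq: "x = Z ^ 9"
    using x powr_realpow[of Z 9] by (simp add: Z_def powr_powr)
  have X_eq: "X = x powr (1/3)"
    using x powr_realpow[of Z 3] by (simp add: X_def Z_def powr_powr)
  have "(512::real) powr (1/9) \<le> Z"
    unfolding Z_def using assms by (intro powr_mono2) auto
  \<comment> \<open>Thus \<open>512 \<le> x\<close> means \<open>Z \<ge> 2\<close>, which is what
    gives \<open>M > Z^5 - 1 \<ge> Z^4\<close>.\<close>
  moreover have "(512::real) powr (1/9) = 2"
    using powr_powr[of 2 9 "1/9"] by simp
  ultimately have Z: "2 \<le> Z" by simp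
  have x_X: "x = X ^ 3" by (simp add: x_eq X_def flip: power_mult)
  have Zpow: "Z ^ i \<le> Z ^ j" if "i \<le> j" for i j using that Z by (intro power_increasing) auto
  have X: "8 \<le> X" "0 < X"
  proof -
    have "2 ^ 3 \<le> Z ^ 3" using Z by (intro power_mono) auto
    then show "8 \<le> X" by (simp add: X_def)
    then show "0 < X" by simp
  qed
  have X_le: "X \<le> x" using Zpow[of 3 9] by (simp add: X_def x_eq)
  have M_le: "real M \<le> Z ^ 5" and M_gt: "Z ^ 5 < real (Suc M)"
  proof -
    have "0 \<le> Z ^ 5" using Z by simp
    then show "real M \<le> Z ^ 5" "Z ^ 5 < real (Suc M)" unfolding M_def by linarith+
  qed
  have M_ge: "Z ^ 4 \<le> real M"
  proof -
    have "Z ^ 5 = Z * Z ^ 4" by (simp add: power_numeral_reduce)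
    moreover have "2 * Z ^ 4 \<le> Z * Z ^ 4" using Z by (intro mult_right_mono) auto
    moreover have "1 \<le> Z ^ 4" using Z by (intro one_le_power) auto
    ultimately show ?thesis using M_gt by simp
  qed
  have M1: "1 \<le> M" using M_ge Zpow[of 0 4] by simp
  have xM: "x / real (Suc M) \<le> Z ^ 4"
  proof -
    have "x = Z ^ 4 * Z ^ 5" by (simp add: x_eq flip: power_add)
    also have "\<dots> \<le> Z ^ 4 * real (Suc M)" using M_gt Z by (intro mult_left_mono) auto
    finally show ?thesis by (simp add: field_simps)
  qed
  have N_le: "real N \<le> x / real (Suc M)" "x / real (Suc M) < real N + 1"
  proof -
    have "0 \<le> x / real (Suc M)" using x by simp
    then show "real N \<le> x / real (Suc M)" "x / real (Suc M) < real N + 1"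
      unfolding N_def by linarith+
  qed
  have NZ: "real N \<le> Z ^ 4" using N_le xM by linarith
  have N0: "real N0 \<le> X" "X < real N0 + 1"
    unfolding N0_def using X by linarith+
  have N0_1: "1 \<le> N0" and N0_half: "X \<le> 2 * real N0" using N0 X by linarith+
  have "exp 1 \<le> x" using exp_le assms by linarith
  then have ln_x: "1 \<le> ln x" using x by (subst ln_ge_iff) auto
  have J: "x < 2 ^ J" "real J \<le> 3 * ln x"
  proof -
    have log_nonneg: "0 \<le> log 2 x" using x by simp
    then have "log 2 x < real J" unfolding J_def by linarith
    then have "x < 2 powr real J" using x by (subst (asm) log_less_iff) auto
    then show "x < 2 ^ J" by (simp add: powr_realpow)
    have "1 / 2 \<le> ln (2::real)" using ln2_ge_two_thirds by linarith
    then have "ln x / ln 2 \<le> ln x / (1 / 2)" using ln_x by (intro divide_left_mono) auto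
    moreover have "real J \<le> log 2 x + 1" unfolding J_def using log_nonneg by linarith
    ultimately show "real J \<le> 3 * ln x" using ln_x by (simp add: log_def)
  qed
  have Mx: "real M \<le> x" "real N \<le> x"
    using M_le NZ Zpow[of 5 9] Zpow[of 4 9] by (auto simp: x_eq)
  have pow_J: "k < 2 ^ J" if "real k \<le> x" for k :: nat
  proof -
    have "real k < 2 ^ J" using that J(1) by linarith
    then show ?thesis by simp
  qed
  have NM: "N \<le> nat \<lfloor>x\<rfloor>" using Mx x by (subst le_nat_floor_iff) auto
  define t where "t m = quot g m / (of_nat m * of_nat (Suc m))" for m
  define E1 where "E1 = (\<Sum>m=1..M. quot g m * of_real (saw (x / real (Suc m)) - saw (x / real m)))"
  \<comment> \<open>The minimum keeps the splitting of \<open>{1..N}\<close> valid whichever of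
    \<open>N0\<close> and \<open>N\<close> is larger.\<close>
  define S0 where "S0 = (\<Sum>n=1..min N0 N. quot g (q n))"
  define S1 where "S1 = (\<Sum>n\<in>{N0<..N}. quot g (q n))"
  define c where "c = real (card {N0<..N})"
  define D0 where "D0 = (\<Sum>d=1..N0. g d / of_nat d ^ 2)"
  define tail where "tail = main_series g - (\<Sum>m=1..M. t m) - D / of_nat (Suc M)"
  have large: "(\<Sum>n\<in>{N<..nat \<lfloor>x\<rfloor>}. quot g (q n)) = of_real x * (\<Sum>m=1..M. t m) + E1"
  proof -
    have "(\<Sum>n\<in>{N<..nat \<lfloor>x\<rfloor>}. quot g (q n))
        = (\<Sum>m=1..M. quot g m * of_real (x / (real m * real (Suc m)) + (saw (x / real (Suc m)) - saw (x / real m))))"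
      unfolding N_def q_def using x by (intro sum_floor_quotients) auto
    then show ?thesis
      by (simp add: E1_def t_def distrib_left sum.distrib sum_distrib_left mult_ac del: of_nat_Suc of_real_diff)
  qed
  have "{1..nat \<lfloor>x\<rfloor>} = {1..N} \<union> {N<..nat \<lfloor>x\<rfloor>}" using NM by auto
  then have "(\<Sum>n=1..nat \<lfloor>x\<rfloor>. quot g (q n)) = (\<Sum>n=1..N. quot g (q n)) + (\<Sum>n\<in>{N<..nat \<lfloor>x\<rfloor>}. quot g (q n))"
    by (simp only:) (subst sum.union_disjoint; auto)
  moreover have "{1..N} = {1..min N0 N} \<union> {N0<..N}" by auto
  then have "(\<Sum>n=1..N. quot g (q n)) = S0 + S1"
    unfolding S0_def S1_def by (simp only:) (subst sum.union_disjoint; auto)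
  moreover have "of_real x * tail = of_real x * main_series g - of_real x * (\<Sum>m=1..M. t m) - D * of_real (x / real (Suc M))"
    by (simp add: tail_def right_diff_distrib mult_ac del: of_nat_Suc)
  \<comment> \<open>The series leaves \<open>- D x/(M + 1)\<close> and the middle range supplies
    \<open>D c\<close>. They meet in \<open>D * (c - x/(M + 1))\<close>, which is harmless since
    \<open>c\<close> is within \<open>2 X\<close> of \<open>x/(M + 1)\<close>.\<close>
  ultimately have "(\<Sum>n=1..nat \<lfloor>x\<rfloor>. quot g (q n)) - of_real x * main_series g
      = E1 + (S0 + ((S1 - of_real c * D0) + (of_real c * (D0 - D) + (D * of_real (c - x / real (Suc M)) - of_real x * tail))))"
    using large by (simp add: algebra_simps)
  also have "norm \<dots> \<le> norm E1 + (norm S0 + (norm (S1 - of_real c * D0) + (norm (of_real c * (D0 - D))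
      + (norm (D * of_real (c - x / real (Suc M))) + norm (of_real x * tail)))))"
    by (intro norm_triangle_le add_left_mono norm_triangle_ineq4)
  also have "\<dots> \<le> G * (1000 * real J * X * zeta43) + (G * (X * (1 + ln x)) + (G * (1000 * real J * (X * zeta43 + 2 * X) + 2 * X)
      + (G * (2 * X) + (G * (4 * X) + G * (16 * X)))))"
  proof (intro add_mono)
    have "real M ^ 3 \<le> (Z ^ 5) ^ 3" using M_le by (intro power_mono) auto
    also have "\<dots> = X ^ 5" by (simp add: X_def flip: power_mult)
    finally show "norm E1 \<le> G * (1000 * real J * X * zeta43)"
      using quot_saw_sum_bound[of X M J] pow_J[OF Mx(1)] X unfolding E1_def x_X by (simp add: mult_ac)
  next
    have "norm S0 \<le> real (min N0 N) * (G * (1 + ln x))"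
      unfolding S0_def q_def using x N0 X_le by (intro quot_small_sum_bound) auto
    also have "\<dots> \<le> X * (G * (1 + ln x))"
      using N0 x G_nonneg by (intro mult_right_mono mult_nonneg_nonneg) auto
    finally show "norm S0 \<le> G * (X * (1 + ln x))" by (simp add: mult_ac)
  next
    have N3: "real N ^ 3 \<le> X ^ 4"
    proof -
      have "real N ^ 3 \<le> (Z ^ 4) ^ 3" using NZ by (intro power_mono) auto
      also have "\<dots> = X ^ 4" by (simp add: X_def flip: power_mult)
      finally show ?thesis .
    qed
    have N2: "(real N)\<^sup>2 \<le> X ^ 3"
    proof -
      have "(real N)\<^sup>2 \<le> (Z ^ 4)\<^sup>2" using NZ by (intro power_mono) auto
      also have "\<dots> = Z ^ 8" by (simp flip: power_mult)
      also have "\<dots> \<le> X ^ 3" using Zpow[of 8 9] by (simp add: X_def flip: power_mult)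
      finally show ?thesis .
    qed
    show "norm (S1 - of_real c * D0) \<le> G * (1000 * real J * (X * zeta43 + 2 * X) + 2 * X)"
      using quot_middle_sum_bound[OF X(2) N0_1 N0 N3 N2 pow_J[OF Mx(2)]]
      unfolding S1_def q_def x_X c_def D0_def by simp
  next
    \<comment> \<open>Truncating the mean value at \<open>N0\<close> costs \<open>G / N0\<close> for
      each of \<open>c \<le> Z^4 \<le> X^2\<close> terms, hence \<open>O(X)\<close> in all.\<close>
    have "c \<le> Z ^ 4" using NZ by (simp add: c_def)
    also have "\<dots> \<le> X * (2 * real N0)"
    proof -
      have "Z ^ 4 \<le> X * X" using Zpow[of 4 6] by (simp add: X_def flip: power_add)
      also have "\<dots> \<le> X * (2 * real N0)" using N0_half X by (intro mult_left_mono) auto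
      finally show ?thesis .
    qed
    finally have "c * (G / real N0) \<le> X * (2 * real N0) * (G / real N0)"
      using G_nonneg by (intro mult_right_mono) auto
    also have "\<dots> = G * (2 * X)" using N0_1 by simp
    finally have c: "c * (G / real N0) \<le> G * (2 * X)" .
    have "norm (of_real c * (D0 - D)) = c * norm (D - D0)"
      by (simp add: norm_mult c_def norm_minus_commute)
    also have "\<dots> \<le> c * (G / real N0)"
      unfolding D_def D0_def using dens_partial_sum[OF N0_1] by (intro mult_left_mono) (auto simp: c_def)
    finally show "norm (of_real c * (D0 - D)) \<le> G * (2 * X)" using c by linarith
  next
    have "\<bar>c - x / real (Suc M)\<bar> \<le> 2 * X"
    proof -
      have "c \<le> real N" "real N - real N0 \<le> c" by (auto simp: c_def)
      then show ?thesis using N_le N0 X by linarith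
    qed
    then have "norm (D * of_real (c - x / real (Suc M))) \<le> (2 * G) * (2 * X)"
      unfolding norm_mult norm_of_real D_def using norm_dens_le G_nonneg
      by (intro mult_mono) auto
    then show "norm (D * of_real (c - x / real (Suc M))) \<le> G * (4 * X)" by simp
  next
    have "norm tail \<le> 16 * G / (real M * sqrt (real M))"
      unfolding tail_def t_def D_def by (rule main_series_tail[OF M1])
    also have "\<dots> \<le> 16 * G / (Z ^ 4 * Z ^ 2)"
    proof -
      have "Z\<^sup>2 \<le> sqrt (real M)"
        by (rule real_le_rsqrt) (use M_ge in \<open>simp flip: power_mult\<close>)
      then have "Z ^ 4 * Z ^ 2 \<le> real M * sqrt (real M)"
        using M_ge by (intro mult_mono) auto
      then show ?thesis using G_nonneg M1 Z by (intro divide_left_mono mult_pos_pos) auto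
    qed
    finally have "x * norm tail \<le> x * (16 * G / (Z ^ 4 * Z ^ 2))"
      using x by (intro mult_left_mono) auto
    also have "\<dots> = G * (16 * X)"
      using Z by (simp add: x_eq X_def power_numeral_reduce)
    finally show "norm (of_real x * tail) \<le> G * (16 * X)"
      using x by (simp add: norm_mult)
  qed
  \<comment> \<open>Here \<open>25 = 1 + 2 + 2 + 4 + 16\<close>. Next \<open>J \<le> 3 ln x\<close>
    turns each \<open>2000\<close> into \<open>6000\<close>, and \<open>ln x + 25\<close> fits into
    \<open>100 ln x\<close> because \<open>ln x \<ge> 1\<close>.\<close>
  also have "\<dots> = G * (X * (2000 * real J * zeta43 + 2000 * real J + ln x + 25))"
    by (simp add: algebra_simps)
  also have "\<dots> \<le> G * (X * ((6000 * zeta43 + 6100) * ln x))"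
  proof (intro mult_left_mono G_nonneg)
    have "real J * zeta43 \<le> (3 * ln x) * zeta43"
      using J zeta43_nonneg by (intro mult_right_mono) auto
    then show "2000 * real J * zeta43 + 2000 * real J + ln x + 25 \<le> (6000 * zeta43 + 6100) * ln x"
      using J(2) ln_x unfolding distrib_right by (simp add: mult_ac)
  qed (use X in simp)
  finally show ?thesis by (simp only: q_def X_eq mult_ac)
qed

end

theorem theorem1p1:
  fixes g :: "nat \<Rightarrow> complex"
  assumes bounded: "\<exists>C. \<forall>n\<ge>1. norm (g n) \<le> C"
  shows "(\<lambda>x::real. (\<Sum>n\<in>{1..nat \<lfloor>x\<rfloor>}.
              id_conv g (nat \<lfloor>x / real n\<rfloor>) / of_nat (nat \<lfloor>x / real n\<rfloor>))
            - of_real x * (\<Sum>m. id_conv g (m + 1) / (of_nat (m + 1) ^ 2 * of_nat (m + 2))))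
         \<in> O[at_top](\<lambda>x. of_real (x powr (1/3) * ln x))"
proof -
  obtain G where G: "\<And>n. 1 \<le> n \<Longrightarrow> norm (g n) \<le> G" using bounded by auto
  have series: "(\<Sum>m. id_conv g (m + 1) / (of_nat (m + 1) ^ 2 * of_nat (m + 2))) = main_series g"
    unfolding main_series_def quot_def
    by (rule arg_cong[where f = suminf]) (auto simp: fun_eq_iff power2_eq_square mult.assoc)
  show ?thesis
    unfolding series quot_def[symmetric]
  proof (rule bigoI[where c = "G * (6000 * zeta43 + 6100)"])
    show "\<forall>\<^sub>F x in at_top. norm ((\<Sum>n\<in>{1..nat \<lfloor>x\<rfloor>}. quot g (nat \<lfloor>x / real n\<rfloor>)) - of_real x * main_series g)
        \<le> G * (6000 * zeta43 + 6100) * norm (of_real (x powr (1/3) * ln x) :: complex)"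
      using eventually_ge_at_top[of "512::real"]
    proof eventually_elim
      case (elim x)
      then have "0 \<le> x powr (1/3) * ln x" by simp
      then show ?case using quot_sum_estimate[OF G elim] by (simp only: norm_of_real abs_of_nonneg)
    qed
  qed
qed

end
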